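(* Let $\mathcal{D}$ denote the diagonal subalgebra of $B(\mathcal{F}(\mathcal{H}))$, i.e. the set of all $x\in B(\mathcal{F}(\mathcal{H}))$ that are diagonal operators with respect to the orthonormal basis $\mathcal{B}=\{e_I : I\in\Lambda\}$ of $\mathcal{F}(\mathcal{H})$. Then $\mathcal{D}\cap H^\infty$ is a diffuse masa in the von Neumann algebra $(H^\infty,\circ)$.
   Context: $\mathcal{H}$ is a separable complex Hilbert space (finite or infinite-dimensional) with $\dim\mathcal{H}>1$ and orthonormal basis $\{e_i : i\in\Theta\}$, where $\Theta=\{1,\dots,n\}$ ($n>1$) or $\Theta=\mathbb{N}=\{1,2,\dots\}$. $\omega=\{\omega_i : i\in\Theta\}$ is a family of strictly positive reals with $\sum_{i\in\Theta}\omega_i=1$. $\mathcal{F}(\mathcal{H})=\bigoplus_{n\ge 0}\mathcal{H}^{\otimes n}$ is the full Fock space, with $\mathcal{H}^{\otimes 0}=\mathbb{C}\Omega$, $\Omega$ the unit vacuum vector. For $\xi\in\mathcal{H}$ the left creation operator is $l_\xi(\eta)=\xi\otimes\eta$ ($\eta\in\mathcal{F}(\mathcal{H})$, $l_\xi\Omega=\xi$), and $l_i:=l_{e_i}$. Markov operator and Poisson boundary: $P_\omega(x)=\sum_{i\in\Theta}\omega_i\, l_i^*xl_i$ for $x\in B(\mathcal{F}(\mathcal{H}))$ (strong operator convergence); it is a normal unital completely positive map. $H^\infty=\{x\in B(\mathcal{F}(\mathcal{H})): P_\omega(x)=x\}$. This $\sigma$-weakly closed operator system is a von Neumann algebra (abstractly)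 with the inherited linear structure, norm, adjoint, unit and $\sigma$-weak topology, and with the Choi-Effros product $x\circ y=\text{SOT-}\lim_{n\to\infty}P_\omega^n(xy)$ (this limit exists), where $xy$ is the usual product of operators. All algebraic notions for $H^\infty$ refer to $\circ$. $\Lambda=\bigcup_{n\ge 0}\Theta^n$ (with $\Theta^0$ consisting of the empty tuple $()$); $e_{()}=\Omega$ and $e_I=e_{i_1}\otimes\cdots\otimes e_{i_k}$ for $I=i_1\cdots i_k$. A masa of a von Neumann algebra $M$ is a maximal abelian von Neumann subalgebra, i.e. an abelian von Neumann subalgebra $A$ with $A'\cap M=A$. A von Neumann subalgebra is diffuse if it has no minimal projection. *)

theory Defs
  imports "HOL-Analysis.Analysis"
begin

section \<open>Complex Hilbert spaces\<close>

text \<open>The inner product \<open>cinner\<close> is linear in its second argument. The norm is the one of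
  the underlying real inner product space, so \<open>(norm x)\<^sup>2 = cinner x x\<close> by
  \<open>inner_eq_Re_cinner\<close> and \<open>cinner_commute\<close>.\<close>

class chilbert_space = real_inner + complete_space +
  fixes scaleC :: "complex \<Rightarrow> 'a \<Rightarrow> 'a" (infixr \<open>*\<^sub>C\<close> 75)
    and cinner :: "'a \<Rightarrow> 'a \<Rightarrow> complex"
  assumes scaleC_add_right: "c *\<^sub>C (x + y) = c *\<^sub>C x + c *\<^sub>C y"
    and scaleC_add_left: "(b + c) *\<^sub>C x = b *\<^sub>C x + c *\<^sub>C x"
    and scaleC_scaleC: "b *\<^sub>C c *\<^sub>C x = (b * c) *\<^sub>C x"
    and scaleR_scaleC: "r *\<^sub>R x = complex_of_real r *\<^sub>C x"
    and cinner_commute: "cinner x y = cnj (cinner y x)"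
    and cinner_add_right: "cinner x (y + z) = cinner x y + cinner x z"
    and cinner_scaleC_right: "cinner x (c *\<^sub>C y) = c * cinner x y"
    and inner_eq_Re_cinner: "inner x y = Re (cinner x y)"

lemma scaleC_one: "1 *\<^sub>C x = (x :: 'a::chilbert_space)"
  using scaleR_scaleC[of 1 x] by simp

interpretation complex_vector: vector_space "scaleC :: complex \<Rightarrow> 'a \<Rightarrow> 'a::chilbert_space"
  by unfold_locales (auto simp: scaleC_add_right scaleC_add_left scaleC_scaleC scaleC_one)

lemma norm_scaleC: "norm (c *\<^sub>C x) = cmod c * norm (x :: 'a::chilbert_space)"
proof -
  have real: "Im (cinner x x) = 0"
    using cinner_commute[of x x] by (simp add: complex_eq_iff)
  have "cinner (c *\<^sub>C x) (c *\<^sub>C x) = c * cnj (c * cinner x x)"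
    by (metis cinner_commute cinner_scaleC_right)
  also have "\<dots> = (c * cnj c) * cnj (cinner x x)"
    by simp
  also have "\<dots> = complex_of_real ((cmod c)\<^sup>2) * cinner x x"
    using real by (simp only: complex_norm_square) (simp add: complex_eq_iff)
  finally have "inner (c *\<^sub>C x) (c *\<^sub>C x) = (cmod c)\<^sup>2 * inner x x"
    by (simp add: inner_eq_Re_cinner)
  then show ?thesis
    by (simp add: norm_eq_sqrt_inner real_sqrt_mult)
qed

definition orthonormal_basis_on :: "'i set \<Rightarrow> ('i \<Rightarrow> 'h::chilbert_space) \<Rightarrow> bool" where
  "orthonormal_basis_on \<Theta> e \<longleftrightarrow>
     (\<forall>i\<in>\<Theta>. \<forall>j\<in>\<Theta>. cinner (e i) (e j) = (if i = j then 1 else 0)) \<and>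
     closure (complex_vector.span (e ` \<Theta>)) = UNIV"

section \<open>Bounded operators\<close>

text \<open>\<open>'f \<Rightarrow>\<^sub>L 'f\<close> is the type of bounded real-linear operators; \<open>B(F)\<close> is the subset of the
  complex-linear ones.\<close>

definition bounded_ops :: "('f::chilbert_space \<Rightarrow>\<^sub>L 'f) set" where
  "bounded_ops = {x :: 'f \<Rightarrow>\<^sub>L 'f. \<forall>c v. x (c *\<^sub>C v) = c *\<^sub>C x v}"

lift_definition scaleC_op :: "complex \<Rightarrow> ('f::chilbert_space \<Rightarrow>\<^sub>L 'f) \<Rightarrow> ('f \<Rightarrow>\<^sub>L 'f)"
  is "\<lambda>c x v. c *\<^sub>C x v"
proof -
  fix c and x :: "'f \<Rightarrow> 'f"
  assume x: "bounded_linear x"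
  have "bounded_linear ((*\<^sub>C) c :: 'f \<Rightarrow> 'f)"
    by (rule bounded_linear_intro[where K = "cmod c"])
       (simp_all add: scaleC_add_right scaleR_scaleC scaleC_scaleC norm_scaleC mult.commute)
  then show "bounded_linear (\<lambda>v. c *\<^sub>C x v)"
    using x by (rule bounded_linear_compose)
qed

definition adjoint_op :: "('f::chilbert_space \<Rightarrow>\<^sub>L 'f) \<Rightarrow> ('f \<Rightarrow>\<^sub>L 'f)" where
  "adjoint_op x = (THE y. y \<in> bounded_ops \<and> (\<forall>v w. cinner (y v) w = cinner v (x w)))"

definition sot_tendsto ::
    "('i \<Rightarrow> ('f::chilbert_space \<Rightarrow>\<^sub>L 'f)) \<Rightarrow> ('f \<Rightarrow>\<^sub>L 'f) \<Rightarrow> 'i filter \<Rightarrow> bool" where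
  "sot_tendsto X y F \<longleftrightarrow> (\<forall>v. ((\<lambda>i. X i v) \<longlongrightarrow> y v) F)"

text \<open>The \<open>\<sigma>\<close>-weak topology on \<open>B(F)\<close>: the coarsest one making all functionals
  \<open>x \<mapsto> \<Sum>k. \<langle>\<xi>\<^sub>k, x \<eta>\<^sub>k\<rangle>\<close> with square-summable \<open>\<xi>\<close> and \<open>\<eta>\<close> continuous.\<close>

definition sigma_weak :: "('f::chilbert_space \<Rightarrow>\<^sub>L 'f) topology" where
  "sigma_weak = topology_generated_by
     {{x :: 'f \<Rightarrow>\<^sub>L 'f. x \<in> bounded_ops \<and> (\<Sum>k. cinner (\<xi> k) (x (\<eta> k))) \<in> U} | \<xi> \<eta> U.
        summable (\<lambda>k::nat. (norm (\<xi> k))\<^sup>2) \<and> summable (\<lambda>k. (norm (\<eta> k))\<^sup>2) \<and> open U}"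

section \<open>Von Neumann subalgebras\<close>

text \<open>The operations and the \<open>\<sigma>\<close>-weak topology of an abstract von Neumann algebra; addition
  and zero are those of the ambient type. The topology is one on the carrier.\<close>

record 'a vn_algebra =
  vn_carrier :: "'a set"
  vn_smult :: "complex \<Rightarrow> 'a \<Rightarrow> 'a"
  vn_mult :: "'a \<Rightarrow> 'a \<Rightarrow> 'a"
  vn_one :: 'a
  vn_star :: "'a \<Rightarrow> 'a"
  vn_topology :: "'a topology"

definition vn_subalgebra :: "'a::ab_group_add vn_algebra \<Rightarrow> 'a set \<Rightarrow> bool" where
  "vn_subalgebra M A \<longleftrightarrow>
     A \<subseteq> vn_carrier M \<and> vn_one M \<in> A \<and>
     (\<forall>x\<in>A. \<forall>y\<in>A. x + y \<in> A \<and> vn_mult M x y \<in> A) \<and>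
     (\<forall>c. \<forall>x\<in>A. vn_smult M c x \<in> A) \<and>
     (\<forall>x\<in>A. vn_star M x \<in> A) \<and>
     closedin (vn_topology M) A"

definition relative_commutant :: "'a vn_algebra \<Rightarrow> 'a set \<Rightarrow> 'a set" where
  "relative_commutant M A = {x \<in> vn_carrier M. \<forall>a\<in>A. vn_mult M a x = vn_mult M x a}"

definition masa :: "'a::ab_group_add vn_algebra \<Rightarrow> 'a set \<Rightarrow> bool" where
  "masa M A \<longleftrightarrow>
     vn_subalgebra M A \<and> (\<forall>x\<in>A. \<forall>y\<in>A. vn_mult M x y = vn_mult M y x) \<and>
     relative_commutant M A = A"

definition projections :: "'a vn_algebra \<Rightarrow> 'a set \<Rightarrow> 'a set" where
  "projections M A = {p \<in> A. vn_star M p = p \<and> vn_mult M p p = p}"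

text \<open>For projections, \<open>q \<le> p\<close> means \<open>p q = q\<close>.\<close>

definition minimal_projection :: "'a::ab_group_add vn_algebra \<Rightarrow> 'a set \<Rightarrow> 'a \<Rightarrow> bool" where
  "minimal_projection M A p \<longleftrightarrow>
     p \<in> projections M A \<and> p \<noteq> 0 \<and>
     (\<forall>q\<in>projections M A. vn_mult M p q = q \<longrightarrow> q = 0 \<or> q = p)"

definition diffuse :: "'a::ab_group_add vn_algebra \<Rightarrow> 'a set \<Rightarrow> bool" where
  "diffuse M A \<longleftrightarrow> (\<nexists>p. minimal_projection M A p)"

section \<open>The full Fock space and its Poisson boundary\<close>

text \<open>\<open>T [\<xi>\<^sub>1, \<dots>, \<xi>\<^sub>n]\<close> is the elementary tensor \<open>\<xi>\<^sub>1 \<otimes> \<dots> \<otimes> \<xi>\<^sub>n\<close> and \<open>T []\<close> is the vacuum vector.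
  The inner product formula makes \<open>T\<close> multilinear on lists of length \<open>n\<close>, identifies the
  closed span of its values there with the \<open>n\<close>-fold Hilbert space tensor power, and makes the
  powers for different \<open>n\<close> orthogonal; totality says that \<open>'f\<close> is their Hilbert space direct
  sum. This determines \<open>('f, T)\<close> up to a unique unitary.\<close>

definition full_fock_space :: "('h::chilbert_space list \<Rightarrow> 'f::chilbert_space) \<Rightarrow> bool" where
  "full_fock_space T \<longleftrightarrow>
     (\<forall>xs ys. cinner (T xs) (T ys) =
        (if length xs = length ys then \<Prod>k<length xs. cinner (xs ! k) (ys ! k) else 0)) \<and>
     closure (complex_vector.span (range T)) = UNIV"

definition creation ::
    "('h::chilbert_space list \<Rightarrow> 'f::chilbert_space) \<Rightarrow> 'h \<Rightarrow> ('f \<Rightarrow>\<^sub>L 'f)" where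
  "creation T \<xi> = (THE x. x \<in> bounded_ops \<and> (\<forall>xs. x (T xs) = T (\<xi> # xs)))"

definition markov_op ::
    "('h::chilbert_space list \<Rightarrow> 'f::chilbert_space) \<Rightarrow> 'i set \<Rightarrow> ('i \<Rightarrow> 'h) \<Rightarrow> ('i \<Rightarrow> real) \<Rightarrow>
     ('f \<Rightarrow>\<^sub>L 'f) \<Rightarrow> ('f \<Rightarrow>\<^sub>L 'f)" where
  "markov_op T \<Theta> e \<omega> x = (THE y. sot_tendsto
     (\<lambda>S. \<Sum>i\<in>S. \<omega> i *\<^sub>R (adjoint_op (creation T (e i)) o\<^sub>L x o\<^sub>L creation T (e i))) y
     (finite_subsets_at_top \<Theta>))"

definition harmonic_ops ::
    "('h::chilbert_space list \<Rightarrow> 'f::chilbert_space) \<Rightarrow> 'i set \<Rightarrow> ('i \<Rightarrow> 'h) \<Rightarrow> ('i \<Rightarrow> real) \<Rightarrow>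
     ('f \<Rightarrow>\<^sub>L 'f) set" where
  "harmonic_ops T \<Theta> e \<omega> = {x \<in> bounded_ops. markov_op T \<Theta> e \<omega> x = x}"

definition choi_effros ::
    "('h::chilbert_space list \<Rightarrow> 'f::chilbert_space) \<Rightarrow> 'i set \<Rightarrow> ('i \<Rightarrow> 'h) \<Rightarrow> ('i \<Rightarrow> real) \<Rightarrow>
     ('f \<Rightarrow>\<^sub>L 'f) \<Rightarrow> ('f \<Rightarrow>\<^sub>L 'f) \<Rightarrow> ('f \<Rightarrow>\<^sub>L 'f)" where
  "choi_effros T \<Theta> e \<omega> x y =
     (THE z. sot_tendsto (\<lambda>n. (markov_op T \<Theta> e \<omega> ^^ n) (x o\<^sub>L y)) z sequentially)"

definition poisson_boundary ::
    "('h::chilbert_space list \<Rightarrow> 'f::chilbert_space) \<Rightarrow> 'i set \<Rightarrow> ('i \<Rightarrow> 'h) \<Rightarrow> ('i \<Rightarrow> real) \<Rightarrow>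
     ('f \<Rightarrow>\<^sub>L 'f) vn_algebra" where
  "poisson_boundary T \<Theta> e \<omega> =
     \<lparr>vn_carrier = harmonic_ops T \<Theta> e \<omega>, vn_smult = scaleC_op, vn_mult = choi_effros T \<Theta> e \<omega>,
      vn_one = id_blinfun, vn_star = adjoint_op,
      vn_topology = subtopology sigma_weak (harmonic_ops T \<Theta> e \<omega>)\<rparr>"

definition diagonal_ops ::
    "('h::chilbert_space list \<Rightarrow> 'f::chilbert_space) \<Rightarrow> 'i set \<Rightarrow> ('i \<Rightarrow> 'h) \<Rightarrow> ('f \<Rightarrow>\<^sub>L 'f) set" where
  "diagonal_ops T \<Theta> e =
     {x :: 'f \<Rightarrow>\<^sub>L 'f. x \<in> bounded_ops \<and> (\<forall>I\<in>lists \<Theta>. \<exists>c. x (T (map e I)) = c *\<^sub>C T (map e I))}"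

end

theory Submission
  imports Defs "HOL-Library.Sublist"
begin

text \<open>
  In the basis \<open>E I\<close> (\<open>I\<close> a word over \<open>\<Theta>\<close>) the creation operator of the letter \<open>i\<close> sends \<open>E I\<close> to
  \<open>E (i # I)\<close>. On matrix coefficients \<open>x(I, J) = \<langle>E I, x (E J)\<rangle>\<close> the Markov operator is therefore the
  averaging operator of a random walk on pairs of words: \<open>(P x)(I, J) = \<Sum>i. \<omega> i * x(i # I, i # J)\<close>,
  and \<open>x\<close> lies in the Poisson boundary iff its coefficients form a bounded harmonic function of this
  walk. The diagonal harmonic operators are the bounded harmonic functions on words, that is, the
  essentially bounded functions on the product space of infinite words (extending to the left) with
  product measure \<open>\<omega>\<close>; a word \<open>K\<close> gives the indicator function \<open>f\<^sub>K\<close> of the words ending in \<open>K\<close>.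
  Concretely, \<open>f\<^sub>K(I)\<close> is \<open>1\<close> or \<open>0\<close> according to whether \<open>I\<close> ends in \<open>K\<close> as soon as \<open>I\<close> is at least
  as long as \<open>K\<close>, and harmonicity determines the values at shorter words.

  For diagonal factors the powers of \<open>P\<close> converge on a product because the averages of the square of
  a harmonic function increase (\<open>product_limit\<close>); this gives the closure of the diagonal algebra under
  the Choi-Effros product. Commutativity is inherited from the usual product, and closedness
  holds because matrix coefficients are \<open>\<sigma>\<close>-weakly continuous.

  Maximality: for harmonic \<open>x\<close>, the powers of \<open>P\<close> become constant on \<open>f\<^sub>K x\<close> and on \<open>x f\<^sub>K\<close>, and at long
  words the two Choi-Effros products have the coefficients \<open>[I ends in K] x(I, J)\<close> and
  \<open>x(I, J) [J ends in K]\<close>. If they agree for all \<open>K\<close>, then \<open>x(I, J) \<noteq> 0\<close> forces one of \<open>I\<close> and \<open>J\<close>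
  to be a suffix of the other. For \<open>I \<noteq> J\<close> this leaves at most one letter \<open>i\<close> with
  \<open>x(i # I, i # J) \<noteq> 0\<close>. A bounded harmonic function that can be followed along one path only is
  zero, because the weights are bounded away from \<open>1\<close> (\<open>harmonic_single_path_zero\<close>). Hence \<open>x\<close>
  is diagonal.

  Diffuseness uses the same principle. If \<open>p\<close> is a minimal projection of the diagonal algebra, then
  the product of \<open>f\<^sub>K\<close> and \<open>p\<close> is \<open>0\<close> or \<open>p\<close> for every \<open>K\<close>. Hence at most one of the values of \<open>p\<close> at the
  words \<open>i # I\<close> is not zero, and \<open>p = 0\<close>.
\<close>

section \<open>Orthonormal bases of complex Hilbert spaces\<close>

instance chilbert_space \<subseteq> banach ..

lemma cinner_add_left: "cinner (x + y) z = cinner x z + cinner (y :: 'f::chilbert_space) z"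
  by (metis cinner_add_right cinner_commute complex_cnj_add)

lemma cinner_scaleC_left: "cinner (c *\<^sub>C x) y = cnj c * cinner x (y :: 'f::chilbert_space)"
  by (metis cinner_commute cinner_scaleC_right complex_cnj_mult)

lemma cinner_self: "cinner x x = complex_of_real ((norm (x :: 'f::chilbert_space))\<^sup>2)"
proof -
  have "Im (cinner x x) = 0"
    using cinner_commute[of x x] by (simp add: complex_eq_iff)
  moreover have "Re (cinner x x) = (norm x)\<^sup>2"
    by (metis inner_eq_Re_cinner power2_norm_eq_inner)
  ultimately show ?thesis
    by (simp add: complex_eq_iff)
qed

text \<open>Rotating \<open>y\<close> by a phase makes the inner product a nonnegative real, where the real
  Cauchy-Schwarz inequality applies.\<close>

lemma cmod_cinner_le: "cmod (cinner x y) \<le> norm x * norm (y :: 'f::chilbert_space)"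
proof (cases "cinner x y = 0")
  case False
  define c where "c = cnj (cinner x y) / cmod (cinner x y)"
  have c: "cmod c = 1"
    using False by (simp add: c_def norm_divide)
  have "cinner x (c *\<^sub>C y) = cmod (cinner x y)"
    using False
    by (simp add: c_def cinner_scaleC_right complex_norm_square[symmetric] power2_eq_square mult.commute)
  then have "cmod (cinner x y) = inner x (c *\<^sub>C y)"
    by (simp add: inner_eq_Re_cinner)
  also have "\<dots> \<le> norm x * norm (c *\<^sub>C y)"
    by (rule norm_cauchy_schwarz)
  finally show ?thesis
    by (simp add: norm_scaleC c)
qed simp

lemma bounded_bilinear_cinner: "bounded_bilinear (cinner :: 'f::chilbert_space \<Rightarrow> 'f \<Rightarrow> complex)"
proof
  show "cinner (r *\<^sub>R a) b = r *\<^sub>R cinner a b" "cinner a (r *\<^sub>R b) = r *\<^sub>R cinner a b" for r and a b :: 'f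
    by (simp_all add: scaleR_scaleC cinner_scaleC_left cinner_scaleC_right scaleR_conv_of_real)
  show "\<exists>K. \<forall>a b :: 'f. norm (cinner a b) \<le> norm a * norm b * K"
    by (intro exI[of _ 1]) (simp add: cmod_cinner_le)
qed (simp_all add: cinner_add_left cinner_add_right)

lemmas cinner_zero_left [simp] = bounded_bilinear.zero_left [OF bounded_bilinear_cinner]
  and cinner_zero_right [simp] = bounded_bilinear.zero_right [OF bounded_bilinear_cinner]
  and cinner_diff_right = bounded_bilinear.diff_right [OF bounded_bilinear_cinner]
  and cinner_sum_left = bounded_bilinear.sum_left [OF bounded_bilinear_cinner]
  and cinner_sum_right = bounded_bilinear.sum_right [OF bounded_bilinear_cinner]
  and bounded_linear_cinner_right = bounded_bilinear.bounded_linear_right [OF bounded_bilinear_cinner]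

lemma cinner_ext:
  fixes x y :: "'f::chilbert_space"
  assumes "\<And>v. cinner v x = cinner v y"
  shows "x = y"
proof -
  have "cinner (x - y) (x - y) = 0"
    using assms by (simp add: cinner_diff_right)
  then show ?thesis
    by (simp add: cinner_self)
qed

lemma bounded_linear_scaleC_left: "bounded_linear (\<lambda>c. c *\<^sub>C (x :: 'f::chilbert_space))"
  by (rule bounded_linear_intro[where K = "norm x"])
     (simp_all add: scaleC_add_left scaleR_scaleC scaleC_scaleC norm_scaleC scaleR_conv_of_real)

lemma bounded_linear_scaleC_right: "bounded_linear (\<lambda>x :: 'f::chilbert_space. c *\<^sub>C x)"
  by (rule bounded_linear_intro[where K = "cmod c"])
     (simp_all add: scaleC_add_right scaleR_scaleC scaleC_scaleC norm_scaleC mult.commute)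

lemma has_sum_unique_cong:
  fixes f g :: "'a \<Rightarrow> 'b::{topological_comm_monoid_add, t2_space}"
  assumes "(f has_sum a) A" "(g has_sum b) A" "\<And>x. x \<in> A \<Longrightarrow> f x = g x"
  shows "a = b"
  using assms has_sum_cong[of A f g a] has_sum_unique[of g A a b] by simp

text \<open>Orthogonality to \<open>v\<close> is a closed linear condition.\<close>

lemma orthogonal_to_total_set:
  fixes v :: "'f::chilbert_space"
  assumes "closure (complex_vector.span S) = UNIV" and "\<And>s. s \<in> S \<Longrightarrow> cinner v s = 0"
  shows "v = 0"
proof -
  have "complex_vector.subspace {x. cinner v x = 0}"
    by (simp add: complex_vector.subspace_def cinner_add_right cinner_scaleC_right)
  then have "complex_vector.span S \<subseteq> {x. cinner v x = 0}"
    using assms(2) by (intro complex_vector.span_minimal) auto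
  moreover have "closed {x. cinner v x = 0}"
    by (intro closed_Collect_eq linear_continuous_on bounded_linear_cinner_right continuous_on_const)
  ultimately have "closure (complex_vector.span S) \<subseteq> {x. cinner v x = 0}"
    by (rule closure_minimal)
  then have "cinner v v = 0"
    using assms(1) by auto
  then show ?thesis
    by (simp add: cinner_self)
qed

text \<open>Totality is stated as triviality of the orthogonal complement, the form in which it can be
  checked for the Fock space.\<close>

locale hilbert_basis =
  fixes B :: "'k set" and E :: "'k \<Rightarrow> 'f::chilbert_space"
  assumes orthonormal: "\<lbrakk>k \<in> B; l \<in> B\<rbrakk> \<Longrightarrow> cinner (E k) (E l) = (if k = l then 1 else 0)"
    and total: "(\<And>k. k \<in> B \<Longrightarrow> cinner (E k) v = 0) \<Longrightarrow> v = 0"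
begin

lemma vector_eqI: "(\<And>k. k \<in> B \<Longrightarrow> cinner (E k) v = cinner (E k) w) \<Longrightarrow> v = w"
  using total[of "v - w"] by (simp add: cinner_diff_right)

lemma norm_basis: "k \<in> B \<Longrightarrow> norm (E k) = 1"
  using orthonormal[of k k] cinner_self[of "E k"] abs_square_eq_1[of "norm (E k)"]
  by (metis abs_norm_cancel of_real_eq_1_iff)

lemma cinner_finite_expansion:
  assumes "finite S" "S \<subseteq> B" "k \<in> B"
  shows "cinner (E k) (\<Sum>l\<in>S. c l *\<^sub>C E l) = (if k \<in> S then c k else 0)"
proof -
  have "cinner (E k) (\<Sum>l\<in>S. c l *\<^sub>C E l) = (\<Sum>l\<in>S. if k = l then c l else 0)"
    unfolding cinner_sum_right cinner_scaleC_right
    using assms by (intro sum.cong) (auto simp: orthonormal subset_iff)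
  then show ?thesis
    using assms by simp
qed

lemma norm_finite_expansion:
  assumes "finite S" "S \<subseteq> B"
  shows "(norm (\<Sum>k\<in>S. c k *\<^sub>C E k))\<^sup>2 = (\<Sum>k\<in>S. (cmod (c k))\<^sup>2)"
proof -
  have "cinner (\<Sum>k\<in>S. c k *\<^sub>C E k) (\<Sum>k\<in>S. c k *\<^sub>C E k) =
      (\<Sum>k\<in>S. cnj (c k) * cinner (E k) (\<Sum>l\<in>S. c l *\<^sub>C E l))"
    by (simp only: cinner_sum_left cinner_scaleC_left)
  also have "\<dots> = (\<Sum>k\<in>S. cnj (c k) * c k)"
    using assms by (intro sum.cong refl) (auto simp: cinner_finite_expansion subset_iff)
  also have "\<dots> = complex_of_real (\<Sum>k\<in>S. (cmod (c k))\<^sup>2)"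
    by (simp only: of_real_sum complex_norm_square mult.commute)
  finally show ?thesis
    by (simp only: cinner_self of_real_eq_iff)
qed

lemma Bessel:
  assumes "finite S" "S \<subseteq> B"
  shows "(\<Sum>k\<in>S. (cmod (cinner (E k) v))\<^sup>2) \<le> (norm v)\<^sup>2"
proof -
  define s where "s = (\<Sum>k\<in>S. cinner (E k) v *\<^sub>C E k)"
  have "cinner s v = (\<Sum>k\<in>S. cnj (cinner (E k) v) * cinner (E k) v)"
    by (simp only: s_def cinner_sum_left cinner_scaleC_left)
  also have "\<dots> = complex_of_real (\<Sum>k\<in>S. (cmod (cinner (E k) v))\<^sup>2)"
    by (simp only: of_real_sum complex_norm_square mult.commute)
  also have "(\<Sum>k\<in>S. (cmod (cinner (E k) v))\<^sup>2) = (norm s)\<^sup>2"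
    using assms by (simp add: s_def norm_finite_expansion)
  finally have "(norm s)\<^sup>2 = cmod (cinner s v)"
    by (simp only: norm_of_real abs_power2)
  also have "\<dots> \<le> norm s * norm v"
    by (rule cmod_cinner_le)
  finally have "norm s \<le> norm v"
    by (cases "s = 0") (auto simp: power2_eq_square)
  then have "(norm s)\<^sup>2 \<le> (norm v)\<^sup>2"
    by (simp add: power_mono)
  then show ?thesis
    using assms by (simp add: s_def norm_finite_expansion)
qed

text \<open>Finite partial sums over disjoint index sets are orthogonal, so the distance of two partial
  sums of the series is controlled by the partial sums of the squares of the coefficients.\<close>

lemma Riesz_Fischer:
  assumes "\<And>S. finite S \<Longrightarrow> S \<subseteq> B \<Longrightarrow> (\<Sum>k\<in>S. (cmod (c k))\<^sup>2) \<le> C"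
  obtains u where "((\<lambda>k. c k *\<^sub>C E k) has_sum u) B" "\<And>k. k \<in> B \<Longrightarrow> cinner (E k) u = c k"
    "(norm u)\<^sup>2 \<le> C"
proof -
  define sq where "sq = (\<lambda>k. (cmod (c k))\<^sup>2)"
  define h where "h = (\<lambda>k. c k *\<^sub>C E k)"
  have "sq summable_on B"
    by (rule nonneg_bdd_above_summable_on) (use assms in \<open>auto simp: sq_def intro!: bdd_aboveI\<close>)
  then obtain L where L: "(sum sq \<longlongrightarrow> L) (finite_subsets_at_top B)"
    by (auto simp: summable_on_def has_sum_def)
  have h_norm: "(norm (sum h S))\<^sup>2 = sum sq S" if "finite S" "S \<subseteq> B" for S
    using norm_finite_expansion[OF that] by (simp add: h_def sq_def)
  have "\<exists>P. eventually P (finite_subsets_at_top B) \<and>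
      (\<forall>F F'. P F \<and> P F' \<longrightarrow> dist (sum h F) (sum h F') < \<epsilon>)" if "\<epsilon> > 0" for \<epsilon>
  proof -
    have "eventually (\<lambda>F. dist (sum sq F) L < \<epsilon>\<^sup>2 / 8) (finite_subsets_at_top B)"
      using L that by (intro tendstoD) auto
    then obtain F0 where F0: "finite F0" "F0 \<subseteq> B"
      "\<And>F. finite F \<Longrightarrow> F0 \<subseteq> F \<Longrightarrow> F \<subseteq> B \<Longrightarrow> dist (sum sq F) L < \<epsilon>\<^sup>2 / 8"
      unfolding eventually_finite_subsets_at_top by (elim exE conjE) (rule that, auto)
    have near: "dist (sum h F) (sum h F0) < \<epsilon> / 2" if F: "finite F" "F0 \<subseteq> F" "F \<subseteq> B" for F
    proof -
      have "(dist (sum h F) (sum h F0))\<^sup>2 = (norm (sum h (F - F0)))\<^sup>2"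
        using F by (simp add: dist_norm sum_diff)
      also have "\<dots> = sum sq F - sum sq F0"
        using F by (subst h_norm) (auto simp: sum_diff)
      also have "\<dots> < \<epsilon>\<^sup>2 / 8 + \<epsilon>\<^sup>2 / 8"
        using F0(3)[OF F] F0(3)[OF F0(1) order.refl F0(2)] by (simp add: dist_real_def abs_if split: if_splits)
      also have "\<dots> = (\<epsilon> / 2)\<^sup>2"
        by (simp add: power2_eq_square)
      finally show ?thesis
        by (rule power_less_imp_less_base) (use \<open>\<epsilon> > 0\<close> in simp)
    qed
    show ?thesis
    proof (intro exI[of _ "\<lambda>F. finite F \<and> F0 \<subseteq> F \<and> F \<subseteq> B"] conjI allI impI)
      show "eventually (\<lambda>F. finite F \<and> F0 \<subseteq> F \<and> F \<subseteq> B) (finite_subsets_at_top B)"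
        unfolding eventually_finite_subsets_at_top using F0(1,2) by blast
      fix F F' assume "(finite F \<and> F0 \<subseteq> F \<and> F \<subseteq> B) \<and> finite F' \<and> F0 \<subseteq> F' \<and> F' \<subseteq> B"
      then show "dist (sum h F) (sum h F') < \<epsilon>"
        using near[of F] near[of F'] dist_triangle2[of "sum h F" "sum h F'" "sum h F0"] by auto
    qed
  qed
  then have "cauchy_filter (filtermap (sum h) (finite_subsets_at_top B))"
    by (simp add: cauchy_filter_metric_filtermap)
  moreover have "complete (UNIV :: 'f set)"
    by (meson Cauchy_convergent UNIV_I complete_def convergent_def)
  ultimately obtain u where u: "(sum h \<longlongrightarrow> u) (finite_subsets_at_top B)"
    using complete_uniform[where S = "UNIV :: 'f set"] by (force simp: filterlim_def)
  show ?thesis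
  proof (rule that[of u])
    show "((\<lambda>k. c k *\<^sub>C E k) has_sum u) B"
      using u by (simp add: has_sum_def h_def)
    show "cinner (E k) u = c k" if k: "k \<in> B" for k
    proof -
      have "((\<lambda>F. cinner (E k) (sum h F)) \<longlongrightarrow> cinner (E k) u) (finite_subsets_at_top B)"
        by (rule bounded_linear.tendsto[OF bounded_linear_cinner_right u])
      moreover have "eventually (\<lambda>F. cinner (E k) (sum h F) = c k) (finite_subsets_at_top B)"
        unfolding eventually_finite_subsets_at_top
        by (rule exI[of _ "{k}"]) (use k in \<open>auto simp: h_def cinner_finite_expansion\<close>)
      ultimately show ?thesis
        by (metis tendsto_eventually tendsto_unique finite_subsets_at_top_neq_bot)
    qed
    have "((\<lambda>F. (norm (sum h F))\<^sup>2) \<longlongrightarrow> (norm u)\<^sup>2) (finite_subsets_at_top B)"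
      by (intro tendsto_intros u)
    then show "(norm u)\<^sup>2 \<le> C"
      by (rule tendsto_upperbound)
         (auto intro!: eventually_finite_subsets_at_top_weakI simp: h_norm assms sq_def)
  qed
qed

lemma expansion: "((\<lambda>k. cinner (E k) v *\<^sub>C E k) has_sum v) B"
proof -
  obtain u where u: "((\<lambda>k. cinner (E k) v *\<^sub>C E k) has_sum u) B"
    "\<And>k. k \<in> B \<Longrightarrow> cinner (E k) u = cinner (E k) v"
    by (rule Riesz_Fischer[of "\<lambda>k. cinner (E k) v" "(norm v)\<^sup>2"]) (rule Bessel, assumption, assumption, rule that)
  then show ?thesis
    using vector_eqI[of u v] by simp
qed

subsection \<open>Bounded operators given by their coefficients\<close>

lemma op_scaleC: "x \<in> bounded_ops \<Longrightarrow> blinfun_apply x (c *\<^sub>C v) = c *\<^sub>C blinfun_apply x v"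
  by (simp add: bounded_ops_def)

lemma op_eqI:
  assumes "x \<in> bounded_ops" "y \<in> bounded_ops" "\<And>k. k \<in> B \<Longrightarrow> blinfun_apply x (E k) = blinfun_apply y (E k)"
  shows "x = y"
proof (rule blinfun_eqI)
  fix v
  have "((\<lambda>k. blinfun_apply x (cinner (E k) v *\<^sub>C E k)) has_sum blinfun_apply x v) B"
    by (rule has_sum_bounded_linear[OF blinfun.bounded_linear_right expansion])
  moreover have "((\<lambda>k. blinfun_apply y (cinner (E k) v *\<^sub>C E k)) has_sum blinfun_apply y v) B"
    by (rule has_sum_bounded_linear[OF blinfun.bounded_linear_right expansion])
  moreover have "blinfun_apply x (cinner (E k) v *\<^sub>C E k) = blinfun_apply y (cinner (E k) v *\<^sub>C E k)"
    if "k \<in> B" for k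
    using that assms by (simp add: op_scaleC)
  ultimately show "blinfun_apply x v = blinfun_apply y v"
    by (rule has_sum_unique_cong)
qed

text \<open>The common source of creation operators, adjoints and diagonal operators: by Riesz-Fischer, a
  square-summable family of linear functionals is the family of coordinates of an operator.\<close>

lemma op_from_coefficients:
  assumes add: "\<And>k v w. k \<in> B \<Longrightarrow> \<psi> k (v + w) = \<psi> k v + \<psi> k w"
    and scale: "\<And>k a v. k \<in> B \<Longrightarrow> \<psi> k (a *\<^sub>C v) = a * \<psi> k v"
    and bound: "\<And>S v. finite S \<Longrightarrow> S \<subseteq> B \<Longrightarrow> (\<Sum>k\<in>S. (cmod (\<psi> k v))\<^sup>2) \<le> (C * norm v)\<^sup>2"
    and C: "C \<ge> 0"
  obtains x where "x \<in> bounded_ops" "\<And>k v. k \<in> B \<Longrightarrow> cinner (E k) (blinfun_apply x v) = \<psi> k v"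
    "norm x \<le> C"
proof -
  have "\<exists>u. (\<forall>k\<in>B. cinner (E k) u = \<psi> k v) \<and> norm u \<le> C * norm v" for v
  proof -
    obtain u where "\<And>k. k \<in> B \<Longrightarrow> cinner (E k) u = \<psi> k v" "(norm u)\<^sup>2 \<le> (C * norm v)\<^sup>2"
      using Riesz_Fischer[of "\<lambda>k. \<psi> k v" "(C * norm v)\<^sup>2"] bound by metis
    then show ?thesis
      using C by (auto intro!: exI[of _ u] power2_le_imp_le mult_nonneg_nonneg)
  qed
  then obtain f where f: "\<And>v k. k \<in> B \<Longrightarrow> cinner (E k) (f v) = \<psi> k v"
    and f_norm: "\<And>v. norm (f v) \<le> C * norm v"
    by metis
  have f_scaleC: "f (a *\<^sub>C v) = a *\<^sub>C f v" for a v
    by (rule vector_eqI) (simp add: f scale cinner_scaleC_right)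
  have "bounded_linear f"
  proof (rule bounded_linear_intro[where K = C])
    show "f (v + w) = f v + f w" for v w
      by (rule vector_eqI) (simp add: f add cinner_add_right)
    show "f (r *\<^sub>R v) = r *\<^sub>R f v" for r v
      by (simp add: scaleR_scaleC f_scaleC)
    show "norm (f v) \<le> norm v * C" for v
      using f_norm[of v] by (simp add: mult.commute)
  qed
  then have apply_f: "blinfun_apply (Blinfun f) = f"
    by (rule bounded_linear_Blinfun_apply)
  show ?thesis
    by (rule that[of "Blinfun f"])
       (auto simp: apply_f bounded_ops_def f_scaleC f f_norm C intro!: norm_blinfun_bound)
qed

lemma adjoint_exists:
  fixes x :: "'f \<Rightarrow>\<^sub>L 'f"
  assumes x: "x \<in> bounded_ops"
  shows "\<exists>!y. y \<in> bounded_ops \<and> (\<forall>v w. cinner (blinfun_apply y v) w = cinner v (blinfun_apply x w))"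
proof -
  have bound: "(\<Sum>k\<in>S. (cmod (cinner (blinfun_apply x (E k)) v))\<^sup>2) \<le> (norm x * norm v)\<^sup>2" (is "?s \<le> _")
    if S: "finite S" "S \<subseteq> B" for S v
  proof -
    \<comment> \<open>Testing \<open>x\<close> against the vector whose coefficients are the numbers to be bounded.\<close>
    define u where "u = (\<Sum>k\<in>S. cinner (blinfun_apply x (E k)) v *\<^sub>C E k)"
    have u: "(norm u)\<^sup>2 = ?s"
      using S by (simp add: u_def norm_finite_expansion)
    have "cinner (blinfun_apply x u) v = (\<Sum>k\<in>S. cnj (cinner (blinfun_apply x (E k)) v) * cinner (blinfun_apply x (E k)) v)"
      by (simp only: u_def blinfun.sum_right op_scaleC[OF x] cinner_sum_left cinner_scaleC_left)
    also have "\<dots> = complex_of_real ?s"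
      by (simp only: of_real_sum complex_norm_square mult.commute)
    finally have "(norm u)\<^sup>2 = cmod (cinner (blinfun_apply x u) v)"
      by (simp only: norm_of_real abs_power2 u[symmetric])
    also have "\<dots> \<le> norm (blinfun_apply x u) * norm v"
      by (rule cmod_cinner_le)
    also have "\<dots> \<le> norm u * (norm x * norm v)"
      using mult_right_mono[OF norm_blinfun[of x u] norm_ge_zero[of v]] by (simp add: mult_ac)
    finally have "norm u \<le> norm x * norm v"
      by (cases "u = 0") (auto simp: power2_eq_square)
    then have "(norm u)\<^sup>2 \<le> (norm x * norm v)\<^sup>2"
      by (simp add: power_mono)
    then show ?thesis
      by (simp add: u)
  qed
  obtain y where y: "y \<in> bounded_ops"
    "\<And>k v. k \<in> B \<Longrightarrow> cinner (E k) (blinfun_apply y v) = cinner (blinfun_apply x (E k)) v"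
    by (rule op_from_coefficients[of "\<lambda>k v. cinner (blinfun_apply x (E k)) v" "norm x"])
       (auto simp: cinner_add_right cinner_scaleC_right intro: bound)
  have "cinner (blinfun_apply y v) w = cinner v (blinfun_apply x w)" for v w
  proof -
    have "((\<lambda>k. cinner (blinfun_apply y v) (cinner (E k) w *\<^sub>C E k)) has_sum cinner (blinfun_apply y v) w) B"
      by (rule has_sum_bounded_linear[OF bounded_linear_cinner_right expansion])
    moreover have "((\<lambda>k. cinner v (blinfun_apply x (cinner (E k) w *\<^sub>C E k))) has_sum cinner v (blinfun_apply x w)) B"
      by (rule has_sum_bounded_linear[OF bounded_linear_compose[OF bounded_linear_cinner_right blinfun.bounded_linear_right] expansion])
    moreover have "cinner (blinfun_apply y v) (cinner (E k) w *\<^sub>C E k) = cinner v (blinfun_apply x (cinner (E k) w *\<^sub>C E k))"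
      if "k \<in> B" for k
    proof -
      have "cinner (blinfun_apply y v) (E k) = cinner v (blinfun_apply x (E k))"
        by (metis y(2)[OF that] cinner_commute)
      then show ?thesis
        by (simp add: op_scaleC[OF x] cinner_scaleC_right)
    qed
    ultimately show ?thesis
      by (rule has_sum_unique_cong)
  qed
  with y(1) show ?thesis
  proof (intro ex1I[of _ y] conjI allI)
    fix z assume z: "z \<in> bounded_ops \<and> (\<forall>v w. cinner (blinfun_apply z v) w = cinner v (blinfun_apply x w))"
    show "z = y"
    proof (rule blinfun_eqI, rule cinner_ext)
      fix v u
      have "cinner (blinfun_apply z v) u = cinner (blinfun_apply y v) u"
        using z \<open>\<And>v w. cinner (blinfun_apply y v) w = cinner v (blinfun_apply x w)\<close> by simp
      then show "cinner u (blinfun_apply z v) = cinner u (blinfun_apply y v)"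
        by (metis cinner_commute)
    qed
  qed auto
qed

lemma
  fixes x :: "'f \<Rightarrow>\<^sub>L 'f"
  assumes "x \<in> bounded_ops"
  shows adjoint_op_bounded: "adjoint_op x \<in> bounded_ops"
    and cinner_adjoint_left: "cinner (blinfun_apply (adjoint_op x) v) w = cinner v (blinfun_apply x w)"
  using theI'[OF adjoint_exists[OF assms]] by (auto simp: adjoint_op_def)

lemma cinner_adjoint_right:
  fixes x :: "'f \<Rightarrow>\<^sub>L 'f"
  shows "x \<in> bounded_ops \<Longrightarrow> cinner v (blinfun_apply (adjoint_op x) w) = cinner (blinfun_apply x v) w"
  by (metis cinner_adjoint_left cinner_commute)

lemma norm_adjoint_le:
  fixes x :: "'f \<Rightarrow>\<^sub>L 'f"
  assumes x: "x \<in> bounded_ops"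
  shows "norm (adjoint_op x) \<le> norm x"
proof (rule norm_blinfun_bound)
  fix v
  let ?u = "blinfun_apply (adjoint_op x) v"
  have "(norm ?u)\<^sup>2 = cmod (cinner ?u ?u)"
    by (simp only: cinner_self norm_of_real abs_power2)
  also have "\<dots> = cmod (cinner v (blinfun_apply x ?u))"
    by (simp add: cinner_adjoint_left[OF x])
  also have "\<dots> \<le> norm v * norm (blinfun_apply x ?u)"
    by (rule cmod_cinner_le)
  also have "\<dots> \<le> norm v * (norm x * norm ?u)"
    by (intro mult_left_mono norm_blinfun) auto
  finally show "norm ?u \<le> norm x * norm v"
    by (cases "norm ?u = 0") (auto simp: power2_eq_square mult_ac)
qed auto

text \<open>For a uniformly bounded sequence of operators, strong convergence only has to be tested on a
  basis: the finite linear combinations of basis vectors approximate every vector.\<close>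

lemma sot_tendsto_if_on_basis:
  assumes X: "\<And>n. X n \<in> bounded_ops" "\<And>n. norm (X n) \<le> C" and y: "y \<in> bounded_ops"
    and lim: "\<And>k. k \<in> B \<Longrightarrow> (\<lambda>n. blinfun_apply (X n) (E k)) \<longlonglongrightarrow> blinfun_apply y (E k)"
  shows "sot_tendsto X y sequentially"
  unfolding sot_tendsto_def
proof
  fix v
  show "(\<lambda>n. blinfun_apply (X n) v) \<longlonglongrightarrow> blinfun_apply y v"
  proof (rule metric_LIMSEQ_I)
    fix \<epsilon> :: real assume \<epsilon>: "\<epsilon> > 0"
    define M where "M = C + norm y + 1"
    have M: "M > 0" "norm (X n) \<le> M" "norm y \<le> M" for n
      using X(2)[of n] norm_ge_zero[of y] norm_ge_zero[of "X n"] unfolding M_def by linarith+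
    obtain S where S: "finite S" "S \<subseteq> B"
      "dist (\<Sum>k\<in>S. cinner (E k) v *\<^sub>C E k) v \<le> \<epsilon> / (4 * M)"
      using has_sum_finite_approximation[OF expansion, of "\<epsilon> / (4 * M)" v] \<epsilon> M by auto
    define s where "s = (\<Sum>k\<in>S. cinner (E k) v *\<^sub>C E k)"
    have s: "norm (v - s) \<le> \<epsilon> / (4 * M)"
      using S by (simp add: s_def dist_norm norm_minus_commute)
    have near: "norm (blinfun_apply z (v - s)) \<le> \<epsilon> / 4" if "norm z \<le> M" for z :: "'f \<Rightarrow>\<^sub>L 'f"
    proof -
      have "norm (blinfun_apply z (v - s)) \<le> norm z * norm (v - s)"
        by (rule norm_blinfun)
      also have "\<dots> \<le> M * (\<epsilon> / (4 * M))"
        using that s M by (intro mult_mono) auto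
      finally show ?thesis
        using M by simp
    qed
    have Xs: "blinfun_apply z s = (\<Sum>k\<in>S. cinner (E k) v *\<^sub>C blinfun_apply z (E k))" if "z \<in> bounded_ops" for z
      unfolding s_def by (simp only: blinfun.sum_right op_scaleC[OF that])
    have "(\<lambda>n. blinfun_apply (X n) s) \<longlonglongrightarrow> blinfun_apply y s"
      unfolding Xs[OF X(1)] Xs[OF y] using S
      by (intro tendsto_sum bounded_linear.tendsto[OF bounded_linear_scaleC_right] lim) auto
    then obtain N where N: "\<And>n. n \<ge> N \<Longrightarrow> dist (blinfun_apply (X n) s) (blinfun_apply y s) < \<epsilon> / 2"
      using metric_LIMSEQ_D[of _ _ "\<epsilon> / 2"] \<epsilon> by (metis half_gt_zero)
    show "\<exists>N. \<forall>n\<ge>N. dist (blinfun_apply (X n) v) (blinfun_apply y v) < \<epsilon>"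
    proof (intro exI[of _ N] allI impI)
      fix n assume n: "n \<ge> N"
      have "blinfun_apply (X n) v - blinfun_apply y v = blinfun_apply (X n) (v - s) - blinfun_apply y (v - s)
          + (blinfun_apply (X n) s - blinfun_apply y s)"
        by (simp add: blinfun.diff_right)
      then have "norm (blinfun_apply (X n) v - blinfun_apply y v) \<le>
          norm (blinfun_apply (X n) (v - s)) + norm (blinfun_apply y (v - s)) + norm (blinfun_apply (X n) s - blinfun_apply y s)"
        using norm_triangle_le norm_triangle_ineq4 by (metis add_right_mono)
      also have "\<dots> < \<epsilon> / 4 + \<epsilon> / 4 + \<epsilon> / 2"
        using near[OF M(2)[of n]] near[OF M(3)] N[OF n] by (simp add: dist_norm)
      finally show "dist (blinfun_apply (X n) v) (blinfun_apply y v) < \<epsilon>"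
        by (simp add: dist_norm)
    qed
  qed
qed

end

section \<open>Bounded harmonic functions of a random walk\<close>

text \<open>The walker at \<open>s\<close> moves to \<open>step i s\<close> with probability \<open>\<omega> i\<close>. With two letters of positive weight
  no letter has weight \<open>1\<close>, so the walk is not deterministic.\<close>

locale random_walk =
  fixes \<Theta> :: "'i set" and \<omega> :: "'i \<Rightarrow> real" and step :: "'i \<Rightarrow> 's \<Rightarrow> 's"
  assumes weight_pos: "i \<in> \<Theta> \<Longrightarrow> \<omega> i > 0"
    and weight_sum: "(\<omega> has_sum 1) \<Theta>"
    and two_letters: "\<exists>a\<in>\<Theta>. \<exists>b\<in>\<Theta>. a \<noteq> b"
begin

definition avg :: "('s \<Rightarrow> complex) \<Rightarrow> 's \<Rightarrow> complex" where
  "avg f s = (\<Sum>\<^sub>\<infinity>i\<in>\<Theta>. of_real (\<omega> i) * f (step i s))"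

lemma avg_has_sum:
  assumes "\<And>s. cmod (f s) \<le> C"
  shows "((\<lambda>i. of_real (\<omega> i) * f (step i s)) has_sum avg f s) \<Theta>"
proof -
  have "(\<lambda>i. \<omega> i * C) summable_on \<Theta>"
    using weight_sum by (intro summable_on_cmult_left) (auto simp: summable_on_def)
  then have "(\<lambda>i. norm (of_real (\<omega> i) * f (step i s))) summable_on \<Theta>"
    by (rule Infinite_Sum.abs_summable_on_comparison_test')
       (use assms weight_pos in \<open>auto simp: norm_mult abs_of_pos intro!: mult_left_mono\<close>)
  then show ?thesis
    unfolding avg_def by (rule has_sum_infsum[OF abs_summable_summable])
qed

lemma avg_bound:
  assumes "\<And>s. cmod (f s) \<le> C"
  shows "cmod (avg f s) \<le> C"
proof -
  have "cmod (avg f s) \<le> 1 * C"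
  proof (rule norm_infsum_le[OF avg_has_sum has_sum_cmult_left[OF weight_sum]])
    fix i assume "i \<in> \<Theta>"
    then show "cmod (of_real (\<omega> i) * f (step i s)) \<le> \<omega> i * C"
      using assms weight_pos[of i] by (auto simp: norm_mult intro!: mult_left_mono)
  qed (rule assms)
  then show ?thesis by simp
qed

lemma avg_pow_bound:
  assumes "\<And>s. cmod (f s) \<le> C"
  shows "cmod ((avg ^^ n) f s) \<le> C"
proof (induction n arbitrary: s)
  case (Suc n)
  show ?case
    unfolding funpow.simps comp_apply by (rule avg_bound) (rule Suc)
qed (simp add: assms)

lemma avg_cong: "(\<And>i. i \<in> \<Theta> \<Longrightarrow> f (step i s) = g (step i s)) \<Longrightarrow> avg f s = avg g s"
  unfolding avg_def by (rule infsum_cong) (rule arg_cong)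

lemma avg_add:
  assumes "\<And>s. cmod (f s) \<le> C" "\<And>s. cmod (g s) \<le> D"
  shows "avg (\<lambda>s. f s + g s) s = avg f s + avg g s"
proof -
  have "cmod (f s + g s) \<le> C + D" for s
    using assms(1)[of s] assms(2)[of s] norm_triangle_ineq[of "f s" "g s"] by linarith
  then have "((\<lambda>i. of_real (\<omega> i) * (f (step i s) + g (step i s))) has_sum avg (\<lambda>s. f s + g s) s) \<Theta>"
    by (rule avg_has_sum)
  moreover have "((\<lambda>i. of_real (\<omega> i) * (f (step i s) + g (step i s))) has_sum avg f s + avg g s) \<Theta>"
    unfolding distrib_left by (rule has_sum_add[OF avg_has_sum[OF assms(1)] avg_has_sum[OF assms(2)]])
  ultimately show ?thesis
    by (rule has_sum_unique)
qed

lemma avg_cmult: "avg (\<lambda>s. c * f s) s = c * avg f s"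
  unfolding avg_def mult.left_commute[of _ c] by (rule infsum_cmult_right')

lemma avg_cnj: "avg (\<lambda>s. cnj (f s)) s = cnj (avg f s)"
  unfolding avg_def infsum_cnj[symmetric] by simp

lemma avg_const: "avg (\<lambda>_. c) s = c"
proof -
  have "((\<lambda>i. of_real (\<omega> i) * c) has_sum of_real 1 * c) \<Theta>"
    by (intro has_sum_cmult_left has_sum_of_real weight_sum)
  then show ?thesis
    by (simp add: avg_def infsumI)
qed

lemma avg_mono:
  assumes "\<And>s. cmod (f s) \<le> C" "\<And>s. cmod (g s) \<le> D" "\<And>s. Re (f s) \<le> Re (g s)"
  shows "Re (avg f s) \<le> Re (avg g s)"
proof (rule has_sum_mono[OF has_sum_Re[OF avg_has_sum[OF assms(1)]] has_sum_Re[OF avg_has_sum[OF assms(2)]]])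
  fix i assume "i \<in> \<Theta>"
  then show "Re (of_real (\<omega> i) * f (step i s)) \<le> Re (of_real (\<omega> i) * g (step i s))"
    using weight_pos[of i] assms(3) by (simp add: mult_left_mono)
qed

text \<open>Dominated convergence for \<open>avg\<close>: the weights dominate the series uniformly in \<open>n\<close>.\<close>

lemma tendsto_avg:
  assumes bound: "\<And>n s. cmod (f n s) \<le> C" and lim: "\<And>s. (\<lambda>n. f n s) \<longlonglongrightarrow> g s"
  shows "(\<lambda>n. avg (f n) s) \<longlonglongrightarrow> avg g s"
proof -
  have bound_g: "cmod (g s) \<le> C" for s
    by (rule tendsto_upperbound[OF tendsto_norm[OF lim[of s]]]) (auto simp: bound)
  have unif: "uniform_limit UNIV (\<lambda>S n. \<Sum>i\<in>S. of_real (\<omega> i) * f n (step i s)) (\<lambda>n. avg (f n) s)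
      (finite_subsets_at_top \<Theta>)"
  proof (rule Weierstrass_m_test_general')
    show "cmod (of_real (\<omega> i) * f n (step i s)) \<le> \<omega> i * C" if "i \<in> \<Theta>" for i n
      using that bound weight_pos[of i] by (auto simp: norm_mult intro!: mult_left_mono)
    show "(\<lambda>i. \<omega> i * C) summable_on \<Theta>"
      using weight_sum by (intro summable_on_cmult_left) (auto simp: summable_on_def)
  qed (rule avg_has_sum[OF bound])
  have sums: "((\<lambda>S. \<Sum>i\<in>S. of_real (\<omega> i) * g (step i s)) \<longlongrightarrow> avg g s) (finite_subsets_at_top \<Theta>)"
    using avg_has_sum[OF bound_g, where s = s] by (simp add: has_sum_def)
  show ?thesis
    by (rule swap_uniform_limit'[OF _ sums unif])
       (auto intro!: always_eventually tendsto_intros lim)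
qed

subsection \<open>Limits of products of harmonic functions\<close>

text \<open>For harmonic \<open>f\<close> the number \<open>avg |f|\<^sup>2 s - |f s|\<^sup>2\<close> is the variance of the value of \<open>f\<close> after
  one step, so the iterated averages of \<open>|f|\<^sup>2\<close> increase.\<close>

lemma avg_square_ge:
  assumes bound: "\<And>s. cmod (f s) \<le> C" and harmonic: "avg f = f"
  shows "(cmod (f s))\<^sup>2 \<le> Re (avg (\<lambda>s. of_real ((cmod (f s))\<^sup>2)) s)"
proof -
  define a where "a = f s"
  have C: "C \<ge> 0"
    using bound[of s] norm_ge_zero order_trans by blast
  have sq: "cmod (of_real ((cmod (f t))\<^sup>2)) \<le> C\<^sup>2" for t
    using bound[of t] by (simp add: power_mono norm_power)
  have lin: "cmod (- cnj a * f t) \<le> C * C" "cmod (- a * cnj (f t)) \<le> C * C" for t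
    using bound C by (auto simp: norm_mult a_def intro!: mult_mono)
  have expand: "of_real ((cmod (f t - a))\<^sup>2) =
      of_real ((cmod (f t))\<^sup>2) + ((- cnj a * f t) + ((- a * cnj (f t)) + of_real ((cmod a)\<^sup>2)))" for t
    by (simp only: complex_norm_square) (simp add: algebra_simps)
  have rest: "cmod ((- a * cnj (f t)) + of_real ((cmod a)\<^sup>2)) \<le> C * C + (cmod a)\<^sup>2" for t
    by (rule order_trans[OF norm_triangle_ineq add_mono[OF lin(2)]]) (simp add: norm_power)
  note rest' = order_trans[OF norm_triangle_ineq add_mono[OF lin(1) rest]]
  have "avg (\<lambda>t. of_real ((cmod (f t - a))\<^sup>2)) s =
      avg (\<lambda>t. of_real ((cmod (f t))\<^sup>2)) s + ((- cnj a * avg f s) + ((- a * cnj (avg f s)) + of_real ((cmod a)\<^sup>2)))"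
    unfolding expand
    by (subst avg_add[OF sq rest'], subst avg_add[OF lin(1) rest], subst avg_add[OF lin(2) order_refl])
       (simp only: avg_cmult avg_cnj avg_const)
  also have "\<dots> = avg (\<lambda>t. of_real ((cmod (f t))\<^sup>2)) s - of_real ((cmod a)\<^sup>2)"
    unfolding harmonic by (simp only: complex_norm_square) (simp add: algebra_simps a_def)
  finally have variance: "avg (\<lambda>t. of_real ((cmod (f t - a))\<^sup>2)) s =
      avg (\<lambda>t. of_real ((cmod (f t))\<^sup>2)) s - of_real ((cmod a)\<^sup>2)" .
  have "cmod (f t - a) \<le> C + cmod a" for t
    using norm_triangle_ineq4[of "f t" a] bound[of t] by linarith
  then have "cmod (of_real ((cmod (f t - a))\<^sup>2)) \<le> (C + cmod a)\<^sup>2" for t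
    by (simp add: power_mono norm_power)
  then have "Re (avg (\<lambda>_. 0) s) \<le> Re (avg (\<lambda>t. of_real ((cmod (f t - a))\<^sup>2)) s)"
    by (intro avg_mono[where C = 0]) auto
  then show ?thesis
    unfolding variance avg_const by (simp add: a_def)
qed

lemma avg_pow_real:
  assumes "\<And>s. Im (f s) = 0"
  shows "Im ((avg ^^ n) f s) = 0"
proof (induction n arbitrary: s)
  case (Suc n)
  then have "avg ((avg ^^ n) f) s = avg (\<lambda>s. cnj ((avg ^^ n) f s)) s"
    by (intro avg_cong) (simp add: complex_eq_iff)
  then show ?case
    by (simp add: avg_cnj complex_eq_iff)
qed (simp add: assms)

lemma avg_pow_square_convergent:
  assumes bound: "\<And>s. cmod (f s) \<le> C" and harmonic: "avg f = f"
  shows "convergent (\<lambda>n. (avg ^^ n) (\<lambda>s. of_real ((cmod (f s))\<^sup>2)) s)"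
proof -
  define q where "q = (\<lambda>s. complex_of_real ((cmod (f s))\<^sup>2))"
  have C: "C \<ge> 0"
    using bound[of s] norm_ge_zero order_trans by blast
  have q: "cmod ((avg ^^ n) q s) \<le> C\<^sup>2" for n s
    by (rule avg_pow_bound) (use bound in \<open>simp add: q_def norm_power power_mono\<close>)
  have "Re ((avg ^^ n) q s) \<le> Re ((avg ^^ Suc n) q s)" for n s
  proof (induction n arbitrary: s)
    case 0
    then show ?case
      using avg_square_ge[OF bound harmonic] by (simp add: q_def)
  next
    case (Suc n)
    show ?case
      unfolding funpow.simps(2)[of "Suc n"] funpow.simps(2)[of n] comp_apply
      by (rule avg_mono[OF q[of n] q[of "Suc n", simplified]]) (use Suc in simp)
  qed
  then have "incseq (\<lambda>n. Re ((avg ^^ n) q s))"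
    by (intro incseq_SucI)
  moreover have "Bseq (\<lambda>n. Re ((avg ^^ n) q s))"
    by (rule BseqI'[of _ "C\<^sup>2"]) (metis abs_Re_le_cmod order_trans q real_norm_def)
  ultimately obtain l where "(\<lambda>n. Re ((avg ^^ n) q s)) \<longlonglongrightarrow> l"
    using Bseq_mono_convergent convergent_def incseq_def by metis
  then have "(\<lambda>n. complex_of_real (Re ((avg ^^ n) q s))) \<longlonglongrightarrow> of_real l"
    by (rule tendsto_of_real)
  moreover have "complex_of_real (Re ((avg ^^ n) q s)) = (avg ^^ n) q s" for n
    using avg_pow_real[of q n s] by (simp add: complex_eq_iff q_def)
  ultimately show ?thesis
    unfolding q_def by (auto simp: convergent_def)
qed

lemma avg_pow_add:
  assumes "\<And>s. cmod (f s) \<le> C" "\<And>s. cmod (g s) \<le> D"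
  shows "(avg ^^ n) (\<lambda>s. f s + g s) s = (avg ^^ n) f s + (avg ^^ n) g s"
proof (induction n arbitrary: s)
  case (Suc n)
  then have "avg ((avg ^^ n) (\<lambda>s. f s + g s)) s = avg (\<lambda>s. (avg ^^ n) f s + (avg ^^ n) g s) s"
    by (intro avg_cong) simp
  also have "\<dots> = avg ((avg ^^ n) f) s + avg ((avg ^^ n) g) s"
    by (rule avg_add[OF avg_pow_bound[OF assms(1)] avg_pow_bound[OF assms(2)]])
  finally show ?case
    by simp
qed simp

lemma avg_pow_cmult: "(avg ^^ n) (\<lambda>s. c * f s) s = c * (avg ^^ n) f s"
proof (induction n arbitrary: s)
  case (Suc n)
  then have "avg ((avg ^^ n) (\<lambda>s. c * f s)) s = avg (\<lambda>s. c * (avg ^^ n) f s) s"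
    by (intro avg_cong) simp
  then show ?case
    by (simp add: avg_cmult)
qed simp

text \<open>Polarization reduces products to squares. The limit is harmonic by dominated convergence.\<close>

lemma product_limit:
  assumes f: "\<And>s. cmod (f s) \<le> C" "avg f = f" and g: "\<And>s. cmod (g s) \<le> D" "avg g = g"
  obtains h where "avg h = h" "\<And>s. cmod (h s) \<le> C * D" "\<And>s. (\<lambda>n. (avg ^^ n) (\<lambda>s. f s * g s) s) \<longlonglongrightarrow> h s"
proof -
  define u where "u = (\<lambda>c s. f s + c * cnj (g s))"
  define q where "q = (\<lambda>c s. complex_of_real ((cmod (u c s))\<^sup>2))"
  have C: "C \<ge> 0" and D: "D \<ge> 0"
    using f(1) g(1) norm_ge_zero order_trans by blast+
  have cg: "cmod (c * cnj (g s)) \<le> cmod c * D" for c s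
    using g(1) by (simp add: norm_mult mult_left_mono)
  have u_bound: "cmod (u c s) \<le> C + cmod c * D" for c s
    unfolding u_def by (rule order_trans[OF norm_triangle_ineq add_mono[OF f(1) cg]])
  have u_harmonic: "avg (u c) = u c" for c
    unfolding u_def by (rule ext, subst avg_add[OF f(1) cg]) (simp add: avg_cmult avg_cnj f g)
  have q_bound: "cmod (a * q c s) \<le> cmod a * (C + cmod c * D)\<^sup>2" for a c s
    using u_bound[of c s] by (simp add: q_def norm_mult norm_power power_mono mult_left_mono)
  have conv: "convergent (\<lambda>n. a * (avg ^^ n) (q c) s)" for a c s
    unfolding q_def
    by (intro convergent_mult convergent_const avg_pow_square_convergent[OF u_bound u_harmonic])
  have polar: "f s * g s = 1/4 * q 1 s + (-1/4 * q (-1) s + (\<i>/4 * q \<i> s + -\<i>/4 * q (-\<i>) s))" for s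
    by (simp only: q_def u_def complex_norm_square) (simp add: algebra_simps)
  have b2: "cmod (\<i>/4 * q \<i> s + -\<i>/4 * q (-\<i>) s) \<le>
      cmod (\<i>/4) * (C + cmod \<i> * D)\<^sup>2 + cmod (-\<i>/4) * (C + cmod (-\<i>) * D)\<^sup>2" for s
    by (rule order_trans[OF norm_triangle_ineq add_mono[OF q_bound q_bound]])
  note b3 = order_trans[OF norm_triangle_ineq add_mono[OF q_bound b2]]
  have split: "(avg ^^ n) (\<lambda>s. f s * g s) s = 1/4 * (avg ^^ n) (q 1) s + (-1/4 * (avg ^^ n) (q (-1)) s +
      (\<i>/4 * (avg ^^ n) (q \<i>) s + -\<i>/4 * (avg ^^ n) (q (-\<i>)) s))" for n s
    unfolding polar
    by (subst avg_pow_add[OF q_bound b3], subst avg_pow_add[OF q_bound b2],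
        subst avg_pow_add[OF q_bound q_bound]) (simp only: avg_pow_cmult)
  have "convergent (\<lambda>n. (avg ^^ n) (\<lambda>s. f s * g s) s)" for s
    unfolding split by (intro convergent_add conv)
  then obtain h where h: "\<And>s. (\<lambda>n. (avg ^^ n) (\<lambda>s. f s * g s) s) \<longlonglongrightarrow> h s"
    unfolding convergent_def by metis
  have fg: "cmod ((avg ^^ n) (\<lambda>s. f s * g s) s) \<le> C * D" for n s
    by (rule avg_pow_bound) (use f(1) g(1) C in \<open>simp add: norm_mult mult_mono\<close>)
  show ?thesis
  proof (rule that[OF _ _ h])
    show "cmod (h s) \<le> C * D" for s
      by (rule tendsto_upperbound[OF tendsto_norm[OF h[of s]]]) (auto simp: fg)
    show "avg h = h"
    proof
      fix s
      have "(\<lambda>n. avg ((avg ^^ n) (\<lambda>s. f s * g s)) s) \<longlonglongrightarrow> avg h s"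
        by (rule tendsto_avg[OF fg h])
      moreover have "(\<lambda>n. avg ((avg ^^ n) (\<lambda>s. f s * g s)) s) \<longlonglongrightarrow> h s"
        using LIMSEQ_Suc[OF h[of s]] by simp
      ultimately show "avg h s = h s"
        by (rule LIMSEQ_unique)
    qed
  qed
qed

subsection \<open>Behaviour far out determines a harmonic function\<close>

text \<open>The walk strictly increases \<open>len\<close>, so after \<open>N\<close> steps it sees only the states with
  \<open>len s \<ge> N\<close>.\<close>

context
  fixes len :: "'s \<Rightarrow> nat"
  assumes len_step: "i \<in> \<Theta> \<Longrightarrow> len (step i s) > len s"
begin

lemma avg_pow_cong_far:
  assumes "\<And>s. len s \<ge> N \<Longrightarrow> f s = g s" "len s + n \<ge> N"
  shows "(avg ^^ n) f s = (avg ^^ n) g s"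
  using assms(2)
proof (induction n arbitrary: s)
  case (Suc n)
  have "avg ((avg ^^ n) f) s = avg ((avg ^^ n) g) s"
  proof (rule avg_cong, rule Suc.IH)
    fix i assume "i \<in> \<Theta>"
    then show "N \<le> len (step i s) + n"
      using len_step[of i s] Suc.prems by simp
  qed
  then show ?case by simp
qed (simp add: assms(1))

lemma avg_pow_fixed: "avg f = f \<Longrightarrow> (avg ^^ n) f = f"
  by (induction n) simp_all

lemma harmonic_eq_if_eq_far:
  assumes "avg f = f" "avg g = g" "\<And>s. len s \<ge> N \<Longrightarrow> f s = g s"
  shows "f = g"
proof
  fix s
  have "(avg ^^ N) f s = (avg ^^ N) g s"
    by (rule avg_pow_cong_far[of N]) (simp_all add: assms(3))
  then show "f s = g s"
    by (simp add: avg_pow_fixed assms)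
qed

text \<open>Each average extends the region where a further average has no effect by one step towards the
  small values of \<open>len\<close>, so after \<open>N\<close> averages it is the whole space.\<close>

lemma eventually_fixed:
  assumes far: "\<And>s. len s \<ge> N \<Longrightarrow> avg f s = f s"
  shows "avg ((avg ^^ N) f) = (avg ^^ N) f"
    and "n \<ge> N \<Longrightarrow> (avg ^^ n) f = (avg ^^ N) f"
    and "len s \<ge> N \<Longrightarrow> (avg ^^ n) f s = f s"
proof -
  show fixed: "avg ((avg ^^ N) f) = (avg ^^ N) f"
  proof
    fix s
    have "(avg ^^ N) (avg f) s = (avg ^^ N) f s"
      by (rule avg_pow_cong_far[of N]) (simp_all add: far)
    then show "avg ((avg ^^ N) f) s = (avg ^^ N) f s"
      by (simp add: funpow_swap1)
  qed
  show "(avg ^^ n) f = (avg ^^ N) f" if "n \<ge> N"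
    using that by (induction n rule: dec_induct) (simp_all add: fixed)
  show "(avg ^^ n) f s = f s" if "len s \<ge> N"
    using that
  proof (induction n arbitrary: s)
    case (Suc n)
    have "avg ((avg ^^ n) f) s = avg f s"
    proof (rule avg_cong, rule Suc.IH)
      fix i assume "i \<in> \<Theta>"
      then show "N \<le> len (step i s)"
        using len_step[of i s] Suc.prems by simp
    qed
    then show ?case
      by (simp add: far[OF Suc.prems])
  qed simp
qed

text \<open>A factor \<open>\<kappa>\<close> that the walk does not change any more behaves like a constant.\<close>

lemma avg_pow_restrict_far:
  assumes "\<And>i s. i \<in> \<Theta> \<Longrightarrow> len s \<ge> N \<Longrightarrow> \<kappa> (step i s) = \<kappa> s"
    and "\<And>s. len s \<ge> N \<Longrightarrow> f s = \<kappa> s * g s" and "len s \<ge> N"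
  shows "(avg ^^ n) f s = \<kappa> s * (avg ^^ n) g s"
  using assms(3)
proof (induction n arbitrary: s)
  case (Suc n)
  have "avg ((avg ^^ n) f) s = avg (\<lambda>t. \<kappa> s * (avg ^^ n) g t) s"
  proof (rule avg_cong)
    fix i assume i: "i \<in> \<Theta>"
    then have "len (step i s) \<ge> N"
      using len_step[of i s] Suc.prems by simp
    then show "(avg ^^ n) f (step i s) = \<kappa> s * (avg ^^ n) g (step i s)"
      using Suc.IH assms(1)[OF i Suc.prems] by simp
  qed
  then show ?case
    by (simp add: avg_cmult)
qed (simp add: assms(2))

end

subsection \<open>Harmonic functions carried by a single path\<close>

lemma weights_bounded_away_from_one:
  obtains c where "0 \<le> c" "c < 1" "\<And>i. i \<in> \<Theta> \<Longrightarrow> \<omega> i \<le> c"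
proof -
  obtain a b where ab: "a \<in> \<Theta>" "b \<in> \<Theta>" "a \<noteq> b"
    using two_letters by blast
  have pair: "\<omega> i + \<omega> j \<le> 1" if "i \<in> \<Theta>" "j \<in> \<Theta>" "i \<noteq> j" for i j
  proof -
    have "sum \<omega> {i, j} \<le> 1"
      by (rule finite_sum_le_has_sum[OF weight_sum]) (use that weight_pos in \<open>auto intro: less_imp_le\<close>)
    then show ?thesis
      using that by simp
  qed
  \<comment> \<open>Every letter other than \<open>a\<close> has at most the remaining weight \<open>1 - \<omega> a\<close>.\<close>
  have "max (\<omega> a) (1 - \<omega> a) < 1"
    using pair[OF ab] weight_pos[OF ab(1)] weight_pos[OF ab(2)] by simp
  moreover have "\<omega> i \<le> max (\<omega> a) (1 - \<omega> a)" if "i \<in> \<Theta>" for i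
    using pair[OF that ab(1)] by (cases "i = a") auto
  ultimately show ?thesis
    using weight_pos[OF ab(1)] by (intro that[of "max (\<omega> a) (1 - \<omega> a)"]) auto
qed

text \<open>Following the only step that leads to a nonzero value of \<open>f\<close> costs a factor \<open>c < 1\<close> each time,
  while \<open>f\<close> stays bounded.\<close>

lemma harmonic_single_path_zero:
  assumes bound: "\<And>s. cmod (f s) \<le> C" and harmonic: "avg f = f"
    and closed: "\<And>i s. i \<in> \<Theta> \<Longrightarrow> s \<in> R \<Longrightarrow> step i s \<in> R"
    and single: "\<And>i j s. \<lbrakk>s \<in> R; i \<in> \<Theta>; j \<in> \<Theta>; f (step i s) \<noteq> 0; f (step j s) \<noteq> 0\<rbrakk> \<Longrightarrow> i = j"
    and "s \<in> R"
  shows "f s = 0"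
proof -
  obtain c where c: "0 \<le> c" "c < 1" "\<And>i. i \<in> \<Theta> \<Longrightarrow> \<omega> i \<le> c"
    using weights_bounded_away_from_one by blast
  have C: "C \<ge> 0"
    using bound[of s] norm_ge_zero order_trans by blast
  have decay: "cmod (f s) \<le> c ^ n * C" if "s \<in> R" for n s
    using that
  proof (induction n arbitrary: s)
    case 0
    then show ?case by (simp add: bound)
  next
    case (Suc n)
    show ?case
    proof (cases "\<exists>i\<in>\<Theta>. f (step i s) \<noteq> 0")
      case True
      then obtain i where i: "i \<in> \<Theta>" "f (step i s) \<noteq> 0" by blast
      have "f (step j s) = 0" if "j \<in> \<Theta> - {i}" for j
        using single[OF Suc.prems i(1) _ i(2)] that by blast
      then have "avg f s = (\<Sum>\<^sub>\<infinity>j\<in>{i}. of_real (\<omega> j) * f (step j s))"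
        unfolding avg_def by (intro infsum_cong_neutral) (use i(1) in auto)
      then have "cmod (f s) = \<omega> i * cmod (f (step i s))"
        using weight_pos[OF i(1)] by (simp add: harmonic norm_mult)
      also have "\<dots> \<le> c * (c ^ n * C)"
        using c i Suc.IH[OF closed[OF i(1) Suc.prems]] weight_pos[OF i(1)] C
        by (intro mult_mono) auto
      finally show ?thesis by simp
    next
      case False
      then have "avg f s = avg (\<lambda>_. 0) s"
        by (intro avg_cong) auto
      then show ?thesis
        using c C by (simp add: harmonic avg_const)
    qed
  qed
  have "(\<lambda>n. c ^ n * C) \<longlonglongrightarrow> 0 * C"
    using c by (intro tendsto_mult LIMSEQ_power_zero tendsto_const) auto
  then have "cmod (f s) \<le> 0 * C"
    by (rule LIMSEQ_le_const) (use decay[OF \<open>s \<in> R\<close>] in auto)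
  then show ?thesis by simp
qed

end

section \<open>The word basis of the Fock space\<close>

locale fock_basis =
  fixes \<Theta> :: "'i set" and e :: "'i \<Rightarrow> 'h::chilbert_space" and T :: "'h list \<Rightarrow> 'f::chilbert_space"
  assumes basis_H: "orthonormal_basis_on \<Theta> e" and fock: "full_fock_space T"
begin

lemma cinner_T_Nil [simp]: "cinner (T []) (T []) = 1"
  using fock by (simp add: full_fock_space_def)

lemma cinner_T_Nil_Cons [simp]:
  "cinner (T []) (T (y # ys)) = 0" "cinner (T (y # ys)) (T []) = 0"
  using fock by (simp_all add: full_fock_space_def)

lemma cinner_T_Cons [simp]: "cinner (T (x # xs)) (T (y # ys)) = cinner x y * cinner (T xs) (T ys)"
  using fock by (auto simp: full_fock_space_def prod.lessThan_Suc_shift simp del: prod.lessThan_Suc)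

lemma T_total: "closure (complex_vector.span (range T)) = UNIV"
  using fock by (simp add: full_fock_space_def)

lemma T_orthogonal: "(\<And>xs. cinner v (T xs) = 0) \<Longrightarrow> v = 0"
  using orthogonal_to_total_set[OF T_total] by auto

lemma norm_T: "norm (T xs) = prod_list (map norm xs)"
proof (induction xs)
  case Nil
  have "complex_of_real ((norm (T []))\<^sup>2) = of_real (1\<^sup>2)"
    using cinner_self[of "T []"] by simp
  then show ?case
    unfolding of_real_eq_iff by (simp add: power2_eq_1_iff) (use norm_ge_zero[of "T []"] in linarith)
next
  case (Cons x xs)
  have "complex_of_real ((norm (T (x # xs)))\<^sup>2) = of_real ((norm x * norm (T xs))\<^sup>2)"
    by (simp only: cinner_self[symmetric] cinner_T_Cons power_mult_distrib of_real_mult)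
  then have "norm (T (x # xs)) = norm x * norm (T xs)"
    unfolding of_real_eq_iff by (rule power2_eq_imp_eq) auto
  then show ?case
    by (simp add: Cons.IH)
qed

text \<open>The weak form of linearity of \<open>T\<close> in one slot; totality turns it into the strong form.\<close>

lemma cinner_T_slot: "\<exists>c k. \<forall>x. cinner (T ys) (T (as @ x # bs)) = c * cinner k x"
proof (induction as arbitrary: ys)
  case Nil
  show ?case
  proof (cases ys)
    case (Cons y ys')
    then show ?thesis
      by (intro exI[of _ "cinner (T ys') (T bs)"] exI[of _ y]) simp
  qed (auto intro: exI[of _ 0])
next
  case (Cons a as)
  show ?case
  proof (cases ys)
    case Y: (Cons y ys')
    obtain c k where "\<And>x. cinner (T ys') (T (as @ x # bs)) = c * cinner k x"
      using Cons.IH by blast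
    then show ?thesis
      using Y by (intro exI[of _ "cinner y a * c"] exI[of _ k]) (simp add: mult.assoc)
  qed (auto intro: exI[of _ 0])
qed

text \<open>Multilinearity of \<open>T\<close> is not an axiom but a consequence of the inner product formula.\<close>

lemma T_slot_add: "T (as @ (x + y) # bs) = T (as @ x # bs) + T (as @ y # bs)"
proof -
  have "T (as @ (x + y) # bs) - (T (as @ x # bs) + T (as @ y # bs)) = 0"
  proof (rule T_orthogonal)
    fix ys
    obtain c k where ck: "\<And>x. cinner (T ys) (T (as @ x # bs)) = c * cinner k x"
      using cinner_T_slot by blast
    have "cinner (T ys) (T (as @ (x + y) # bs) - (T (as @ x # bs) + T (as @ y # bs))) = 0"
      by (simp add: cinner_diff_right cinner_add_right ck algebra_simps)
    then show "cinner (T (as @ (x + y) # bs) - (T (as @ x # bs) + T (as @ y # bs))) (T ys) = 0"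
      by (metis cinner_commute complex_cnj_zero)
  qed
  then show ?thesis
    by simp
qed

lemma T_slot_scaleC: "T (as @ (a *\<^sub>C x) # bs) = a *\<^sub>C T (as @ x # bs)"
proof -
  have "T (as @ (a *\<^sub>C x) # bs) - a *\<^sub>C T (as @ x # bs) = 0"
  proof (rule T_orthogonal)
    fix ys
    obtain c k where ck: "\<And>x. cinner (T ys) (T (as @ x # bs)) = c * cinner k x"
      using cinner_T_slot by blast
    have "cinner (T ys) (T (as @ (a *\<^sub>C x) # bs) - a *\<^sub>C T (as @ x # bs)) = 0"
      by (simp add: cinner_diff_right cinner_scaleC_right ck algebra_simps)
    then show "cinner (T (as @ (a *\<^sub>C x) # bs) - a *\<^sub>C T (as @ x # bs)) (T ys) = 0"
      by (metis cinner_commute complex_cnj_zero)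
  qed
  then show ?thesis
    by simp
qed

lemma bounded_linear_T_slot: "bounded_linear (\<lambda>x. T (as @ x # bs))"
  by (rule bounded_linear_intro[where K = "prod_list (map norm as) * prod_list (map norm bs)"])
     (simp_all add: T_slot_add T_slot_scaleC scaleR_scaleC norm_T mult_ac)

definition E :: "'i list \<Rightarrow> 'f" where
  "E I = T (map e I)"

lemma cinner_e: "\<lbrakk>i \<in> \<Theta>; j \<in> \<Theta>\<rbrakk> \<Longrightarrow> cinner (e i) (e j) = (if i = j then 1 else 0)"
  using basis_H by (simp add: orthonormal_basis_on_def)

lemma cinner_E_Cons [simp]:
  "cinner (E []) (E (j # J)) = 0" "cinner (E (j # J)) (E []) = 0" "cinner (E []) (E []) = 1"
  "cinner (E (i # I)) (E (j # J)) = cinner (e i) (e j) * cinner (E I) (E J)"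
  by (simp_all add: E_def)

text \<open>The entries of an arbitrary elementary tensor are replaced by basis vectors one at a time, which
  is possible because each slot of \<open>T\<close> is linear and continuous.\<close>

lemma E_orthogonal:
  assumes v: "\<And>I. I \<in> lists \<Theta> \<Longrightarrow> cinner v (E I) = 0"
  shows "v = 0"
proof (rule T_orthogonal)
  fix xs
  have "cinner v (T (map e I @ xs)) = 0" if "I \<in> lists \<Theta>" for I
    using that
  proof (induction xs arbitrary: I)
    case Nil
    then show ?case
      using v[of I] by (simp add: E_def)
  next
    case (Cons x xs)
    define Z where "Z = {x. cinner v (T (map e I @ x # xs)) = 0}"
    have lin: "bounded_linear (\<lambda>x. cinner v (T (map e I @ x # xs)))"
      by (rule bounded_linear_compose[OF bounded_linear_cinner_right bounded_linear_T_slot])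
    have "complex_vector.subspace Z"
      using linear_0[OF bounded_linear.linear[OF lin]]
      by (simp add: Z_def complex_vector.subspace_def T_slot_add T_slot_scaleC cinner_add_right cinner_scaleC_right)
    moreover have "e ` \<Theta> \<subseteq> Z"
    proof
      fix y assume "y \<in> e ` \<Theta>"
      then obtain i where "i \<in> \<Theta>" "y = e i" by blast
      then show "y \<in> Z"
        using Cons.IH[of "I @ [i]"] Cons.prems by (simp add: Z_def)
    qed
    ultimately have "complex_vector.span (e ` \<Theta>) \<subseteq> Z"
      by (intro complex_vector.span_minimal)
    moreover have "closed Z"
      unfolding Z_def by (intro closed_Collect_eq linear_continuous_on lin continuous_on_const)
    ultimately have "closure (complex_vector.span (e ` \<Theta>)) \<subseteq> Z"
      by (rule closure_minimal)
    then show ?case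
      using basis_H by (auto simp: orthonormal_basis_on_def Z_def)
  qed
  from this[of "[]"] show "cinner v (T xs) = 0"
    by simp
qed

sublocale hilbert_basis "lists \<Theta>" E
proof
  show "cinner (E I) (E J) = (if I = J then 1 else 0)" if "I \<in> lists \<Theta>" "J \<in> lists \<Theta>" for I J
    using that
  proof (induction I arbitrary: J)
    case Nil
    then show ?case by (cases J) auto
  next
    case (Cons i I)
    then show ?case by (cases J) (auto simp: cinner_e)
  qed
  show "v = 0" if "\<And>I. I \<in> lists \<Theta> \<Longrightarrow> cinner (E I) v = 0" for v
    using that by (intro E_orthogonal) (metis cinner_commute complex_cnj_zero)
qed

lemma creation_exists:
  assumes i: "i \<in> \<Theta>"
  shows "\<exists>!x. x \<in> bounded_ops \<and> (\<forall>xs. blinfun_apply x (T xs) = T (e i # xs))"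
    and "\<exists>x. x \<in> bounded_ops \<and> (\<forall>xs. blinfun_apply x (T xs) = T (e i # xs)) \<and> norm x \<le> 1"
proof -
  \<comment> \<open>The coordinates of the image: only words beginning with \<open>i\<close> occur.\<close>
  define \<psi> where "\<psi> = (\<lambda>K v. case K of [] \<Rightarrow> 0 | k # I \<Rightarrow> if k = i then cinner (E I) v else 0)"
  have bound: "(\<Sum>K\<in>S. (cmod (\<psi> K v))\<^sup>2) \<le> (1 * norm v)\<^sup>2" if S: "finite S" "S \<subseteq> lists \<Theta>" for S v
  proof -
    define R where "R = {I. i # I \<in> S}"
    have R: "finite R" "R \<subseteq> lists \<Theta>"
      using S finite_vimageI[OF S(1), of "Cons i"] by (auto simp: R_def vimage_def)
    have "(\<Sum>K\<in>S. (cmod (\<psi> K v))\<^sup>2) = (\<Sum>K\<in>Cons i ` R. (cmod (\<psi> K v))\<^sup>2)"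
    proof (rule sum.mono_neutral_right[OF S(1)])
      show "\<forall>K\<in>S - Cons i ` R. (cmod (\<psi> K v))\<^sup>2 = 0"
        by (auto simp: \<psi>_def R_def split: list.splits)
    qed (auto simp: R_def)
    also have "\<dots> = (\<Sum>I\<in>R. (cmod (cinner (E I) v))\<^sup>2)"
      by (subst sum.reindex) (auto simp: \<psi>_def)
    finally show ?thesis
      using Bessel[OF R] by simp
  qed
  obtain x where x: "x \<in> bounded_ops" "norm x \<le> 1"
    "\<And>K v. K \<in> lists \<Theta> \<Longrightarrow> cinner (E K) (blinfun_apply x v) = \<psi> K v"
    by (rule op_from_coefficients[of \<psi> 1])
       (auto simp: \<psi>_def cinner_add_right cinner_scaleC_right split: list.splits intro: bound[unfolded \<psi>_def, simplified])
  have xT: "blinfun_apply x (T xs) = T (e i # xs)" for xs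
  proof (rule vector_eqI)
    fix K assume "K \<in> lists \<Theta>"
    then show "cinner (E K) (blinfun_apply x (T xs)) = cinner (E K) (T (e i # xs))"
      using i unfolding x(3)[OF \<open>K \<in> lists \<Theta>\<close>] by (cases K) (auto simp: \<psi>_def E_def cinner_e)
  qed
  show "\<exists>x. x \<in> bounded_ops \<and> (\<forall>xs. blinfun_apply x (T xs) = T (e i # xs)) \<and> norm x \<le> 1"
    using x xT by blast
  show "\<exists>!x. x \<in> bounded_ops \<and> (\<forall>xs. blinfun_apply x (T xs) = T (e i # xs))"
  proof (rule ex1I[of _ x])
    show "x \<in> bounded_ops \<and> (\<forall>xs. blinfun_apply x (T xs) = T (e i # xs))"
      using x(1) xT by simp
    show "y = x" if y: "y \<in> bounded_ops \<and> (\<forall>xs. blinfun_apply y (T xs) = T (e i # xs))" for y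
      by (rule op_eqI) (use y x(1) xT in \<open>simp_all add: E_def\<close>)
  qed
qed

lemma
  assumes "i \<in> \<Theta>"
  shows creation_bounded: "creation T (e i) \<in> bounded_ops"
    and creation_E: "blinfun_apply (creation T (e i)) (E I) = E (i # I)"
    and norm_creation: "norm (creation T (e i)) \<le> 1"
proof -
  have l: "creation T (e i) \<in> bounded_ops \<and> (\<forall>xs. blinfun_apply (creation T (e i)) (T xs) = T (e i # xs))"
    unfolding creation_def by (rule theI'[OF creation_exists(1)[OF assms]])
  then show "creation T (e i) \<in> bounded_ops" "blinfun_apply (creation T (e i)) (E I) = E (i # I)"
    by (simp_all add: E_def)
  show "norm (creation T (e i)) \<le> 1"
    using l creation_exists[OF assms] by metis
qed

end

section \<open>The Markov operator as a walk on pairs of words\<close>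

locale fock_walk = fock_basis \<Theta> e T
  for \<Theta> :: "'i set" and e :: "'i \<Rightarrow> 'h::chilbert_space" and T :: "'h list \<Rightarrow> 'f::chilbert_space" +
  fixes \<omega> :: "'i \<Rightarrow> real"
  assumes weight_pos: "i \<in> \<Theta> \<Longrightarrow> \<omega> i > 0"
    and weight_sum: "(\<omega> has_sum 1) \<Theta>"
    and two_letters: "\<exists>a\<in>\<Theta>. \<exists>b\<in>\<Theta>. a \<noteq> b"
begin

sublocale random_walk \<Theta> \<omega> "\<lambda>i s. (i # fst s, i # snd s)"
  by unfold_locales (auto simp: weight_pos weight_sum two_letters)

text \<open>The value \<open>0\<close> at pairs that contain a letter outside \<open>\<Theta>\<close> makes \<open>mat (P x) = avg (mat x)\<close> an
  identity of functions on all pairs.\<close>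

definition mat :: "('f \<Rightarrow>\<^sub>L 'f) \<Rightarrow> 'i list \<times> 'i list \<Rightarrow> complex" where
  "mat x s = (if fst s \<in> lists \<Theta> \<and> snd s \<in> lists \<Theta>
     then cinner (E (fst s)) (blinfun_apply x (E (snd s))) else 0)"

abbreviation P :: "('f \<Rightarrow>\<^sub>L 'f) \<Rightarrow> ('f \<Rightarrow>\<^sub>L 'f)" where
  "P \<equiv> markov_op T \<Theta> e \<omega>"

lemma mat_bound: "cmod (mat x s) \<le> norm x"
proof (cases "fst s \<in> lists \<Theta> \<and> snd s \<in> lists \<Theta>")
  case True
  have "cmod (mat x s) \<le> norm (E (fst s)) * norm (blinfun_apply x (E (snd s)))"
    using True by (simp add: mat_def cmod_cinner_le)
  also have "\<dots> \<le> norm (E (fst s)) * (norm x * norm (E (snd s)))"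
    by (intro mult_left_mono norm_blinfun) auto
  finally show ?thesis
    using True by (simp add: norm_basis)
qed (auto simp: mat_def)

lemma mat_inject:
  assumes "x \<in> bounded_ops" "y \<in> bounded_ops" "mat x = mat y"
  shows "x = y"
proof (rule op_eqI[OF assms(1,2)], rule vector_eqI)
  fix J I assume "J \<in> lists \<Theta>" "I \<in> lists \<Theta>"
  then show "cinner (E I) (blinfun_apply x (E J)) = cinner (E I) (blinfun_apply y (E J))"
    using fun_cong[OF assms(3), of "(I, J)"] by (simp add: mat_def)
qed

text \<open>The series of the Markov operator even converges in norm, since its terms are bounded by
  \<open>\<omega> i * norm x\<close>.\<close>

lemma markov_has_sum:
  assumes x: "x \<in> bounded_ops"
  shows "((\<lambda>i. \<omega> i *\<^sub>R (adjoint_op (creation T (e i)) o\<^sub>L x o\<^sub>L creation T (e i))) has_sum P x) \<Theta>"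
    and "norm (P x) \<le> norm x"
proof -
  define t where "t = (\<lambda>i. \<omega> i *\<^sub>R (adjoint_op (creation T (e i)) o\<^sub>L x o\<^sub>L creation T (e i)))"
  have t_norm: "norm (t i) \<le> \<omega> i * norm x" if i: "i \<in> \<Theta>" for i
  proof -
    let ?l = "creation T (e i)"
    have "norm (adjoint_op ?l) \<le> 1"
      using norm_adjoint_le[OF creation_bounded[OF i]] norm_creation[OF i] by simp
    have "norm (adjoint_op ?l o\<^sub>L x o\<^sub>L ?l) \<le> norm (adjoint_op ?l o\<^sub>L x) * norm ?l"
      by (rule norm_blinfun_compose)
    also have "\<dots> \<le> (norm (adjoint_op ?l) * norm x) * norm ?l"
      by (intro mult_right_mono norm_blinfun_compose) auto
    also have "\<dots> \<le> (1 * norm x) * 1"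
      using \<open>norm (adjoint_op ?l) \<le> 1\<close> norm_creation[OF i] by (intro mult_mono) auto
    finally show ?thesis
      using weight_pos[OF i] by (simp add: t_def)
  qed
  have bound: "((\<lambda>i. \<omega> i * norm x) has_sum norm x) \<Theta>"
    using has_sum_cmult_left[OF weight_sum, of "norm x"] by simp
  then have "(\<lambda>i. norm (t i)) summable_on \<Theta>"
    by (intro Infinite_Sum.abs_summable_on_comparison_test'[OF _ t_norm]) (auto simp: summable_on_def)
  then obtain y where y: "(t has_sum y) \<Theta>"
    using abs_summable_summable[of t \<Theta>] summable_on_def by metis
  have lim: "((\<lambda>S. blinfun_apply (sum t S) v) \<longlongrightarrow> blinfun_apply y v) (finite_subsets_at_top \<Theta>)" for v
    using y unfolding has_sum_def by (rule bounded_linear.tendsto[OF blinfun.bounded_linear_left])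
  have "P x = y"
    unfolding markov_op_def t_def[symmetric]
  proof (rule the_equality)
    show "sot_tendsto (sum t) y (finite_subsets_at_top \<Theta>)"
      using lim by (simp add: sot_tendsto_def)
    fix z assume "sot_tendsto (sum t) z (finite_subsets_at_top \<Theta>)"
    then have "((\<lambda>S. blinfun_apply (sum t S) v) \<longlongrightarrow> blinfun_apply z v) (finite_subsets_at_top \<Theta>)" for v
      by (simp add: sot_tendsto_def)
    then show "z = y"
      by (intro blinfun_eqI tendsto_unique[OF finite_subsets_at_top_neq_bot _ lim])
  qed
  then show "(t has_sum P x) \<Theta>"
    using y by simp
  then show "norm (P x) \<le> norm x"
    by (rule norm_infsum_le[OF _ bound t_norm])
qed

lemma markov_bounded:
  assumes x: "x \<in> bounded_ops"
  shows "P x \<in> bounded_ops"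
proof -
  have "blinfun_apply (P x) (c *\<^sub>C v) = c *\<^sub>C blinfun_apply (P x) v" for c v
  proof (rule has_sum_unique_cong)
    show "((\<lambda>i. blinfun_apply (\<omega> i *\<^sub>R (adjoint_op (creation T (e i)) o\<^sub>L x o\<^sub>L creation T (e i))) (c *\<^sub>C v))
        has_sum blinfun_apply (P x) (c *\<^sub>C v)) \<Theta>"
      by (rule has_sum_bounded_linear[OF blinfun.bounded_linear_left markov_has_sum(1)[OF x]])
    show "((\<lambda>i. c *\<^sub>C blinfun_apply (\<omega> i *\<^sub>R (adjoint_op (creation T (e i)) o\<^sub>L x o\<^sub>L creation T (e i))) v)
        has_sum c *\<^sub>C blinfun_apply (P x) v) \<Theta>"
      by (rule has_sum_bounded_linear[OF bounded_linear_compose[OF bounded_linear_scaleC_right blinfun.bounded_linear_left] markov_has_sum(1)[OF x]])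
    fix i assume i: "i \<in> \<Theta>"
    show "blinfun_apply (\<omega> i *\<^sub>R (adjoint_op (creation T (e i)) o\<^sub>L x o\<^sub>L creation T (e i))) (c *\<^sub>C v) =
        c *\<^sub>C blinfun_apply (\<omega> i *\<^sub>R (adjoint_op (creation T (e i)) o\<^sub>L x o\<^sub>L creation T (e i))) v"
      by (simp add: blinfun.scaleR_left op_scaleC x creation_bounded[OF i] adjoint_op_bounded
          scaleR_scaleC scaleC_scaleC mult.commute)
  qed
  then show ?thesis
    by (simp add: bounded_ops_def)
qed

lemma mat_markov:
  assumes x: "x \<in> bounded_ops"
  shows "mat (P x) = avg (mat x)"
proof
  fix s :: "'i list \<times> 'i list"
  obtain I J where s: "s = (I, J)" by fastforce
  show "mat (P x) s = avg (mat x) s"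
  proof (cases "I \<in> lists \<Theta> \<and> J \<in> lists \<Theta>")
    case True
    have "((\<lambda>i. cinner (E I) (blinfun_apply (\<omega> i *\<^sub>R (adjoint_op (creation T (e i)) o\<^sub>L x o\<^sub>L creation T (e i))) (E J)))
        has_sum cinner (E I) (blinfun_apply (P x) (E J))) \<Theta>"
      by (rule has_sum_bounded_linear[OF bounded_linear_compose[OF bounded_linear_cinner_right blinfun.bounded_linear_left] markov_has_sum(1)[OF x]])
    moreover have "cinner (E I) (blinfun_apply (\<omega> i *\<^sub>R (adjoint_op (creation T (e i)) o\<^sub>L x o\<^sub>L creation T (e i))) (E J)) =
        of_real (\<omega> i) * mat x (i # fst s, i # snd s)" if "i \<in> \<Theta>" for i
      using True that
      by (simp add: blinfun.scaleR_left scaleR_scaleC cinner_scaleC_right creation_E cinner_adjoint_right creation_bounded mat_def s)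
    ultimately have "((\<lambda>i. of_real (\<omega> i) * mat x (i # fst s, i # snd s)) has_sum cinner (E I) (blinfun_apply (P x) (E J))) \<Theta>"
      by (subst has_sum_cong[symmetric]) auto
    then show ?thesis
      using True by (simp add: avg_def infsumI) (simp add: mat_def s)
  next
    case False
    then have "avg (mat x) s = avg (\<lambda>_. 0) s"
      by (intro avg_cong) (auto simp: mat_def s)
    then show ?thesis
      using False by (auto simp: avg_const mat_def s)
  qed
qed

lemma markov_pow:
  assumes "x \<in> bounded_ops"
  shows "(P ^^ n) x \<in> bounded_ops" "mat ((P ^^ n) x) = (avg ^^ n) (mat x)" "norm ((P ^^ n) x) \<le> norm x"
proof (induction n)
  case (Suc n)
  { case 1 show ?case using Suc(1) by (simp add: markov_bounded) }
  { case 2 show ?case using Suc(1,2) by (simp add: mat_markov) }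
  { case 3 show ?case using markov_has_sum(2)[OF Suc(1)] Suc(3) by simp }
qed (use assms in auto)

lemma harmonic_iff: "x \<in> harmonic_ops T \<Theta> e \<omega> \<longleftrightarrow> x \<in> bounded_ops \<and> avg (mat x) = mat x"
  unfolding harmonic_ops_def using mat_markov[of x] mat_inject[OF markov_bounded, of x x] by auto

subsection \<open>Matrix coefficients of algebraic operations\<close>

lemma bounded_ops_closed:
  fixes x y :: "'f \<Rightarrow>\<^sub>L 'f"
  shows "id_blinfun \<in> (bounded_ops :: ('f \<Rightarrow>\<^sub>L 'f) set)"
    and "x \<in> bounded_ops \<Longrightarrow> y \<in> bounded_ops \<Longrightarrow> x + y \<in> bounded_ops"
    and "x \<in> bounded_ops \<Longrightarrow> y \<in> bounded_ops \<Longrightarrow> x o\<^sub>L y \<in> bounded_ops"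
    and "x \<in> bounded_ops \<Longrightarrow> scaleC_op c x \<in> bounded_ops"
  by (simp_all add: bounded_ops_def blinfun.add_left scaleC_add_right scaleC_op.rep_eq scaleC_scaleC mult.commute)

lemma mat_add: "mat (x + y) = (\<lambda>s. mat x s + mat y s)"
  by (auto simp: mat_def blinfun.add_left cinner_add_right)

lemma mat_scaleC: "mat (scaleC_op c x) = (\<lambda>s. c * mat x s)"
  by (auto simp: mat_def scaleC_op.rep_eq cinner_scaleC_right)

lemma mat_id: "mat id_blinfun (I, J) = (if I = J \<and> I \<in> lists \<Theta> then 1 else 0)"
  by (auto simp: mat_def orthonormal)

lemma mat_adjoint: "x \<in> bounded_ops \<Longrightarrow> mat (adjoint_op x) (I, J) = cnj (mat x (J, I))"
  using cinner_commute[of "blinfun_apply x (E I)" "E J"]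
  by (simp add: mat_def cinner_adjoint_right)

lemma diagonal_iff:
  "x \<in> diagonal_ops T \<Theta> e \<longleftrightarrow> x \<in> bounded_ops \<and> (\<forall>I J. I \<noteq> J \<longrightarrow> mat x (I, J) = 0)"
proof
  assume x: "x \<in> diagonal_ops T \<Theta> e"
  have "mat x (I, J) = 0" if "I \<noteq> J" for I J
  proof (cases "I \<in> lists \<Theta> \<and> J \<in> lists \<Theta>")
    case True
    then obtain c where "blinfun_apply x (E J) = c *\<^sub>C E J"
      using x unfolding diagonal_ops_def E_def by blast
    then show ?thesis
      using True that by (simp add: mat_def cinner_scaleC_right orthonormal)
  qed (auto simp: mat_def)
  then show "x \<in> bounded_ops \<and> (\<forall>I J. I \<noteq> J \<longrightarrow> mat x (I, J) = 0)"
    using x by (simp add: diagonal_ops_def)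
next
  assume x: "x \<in> bounded_ops \<and> (\<forall>I J. I \<noteq> J \<longrightarrow> mat x (I, J) = 0)"
  have "blinfun_apply x (E J) = mat x (J, J) *\<^sub>C E J" if J: "J \<in> lists \<Theta>" for J
  proof (rule vector_eqI)
    fix I assume I: "I \<in> lists \<Theta>"
    then show "cinner (E I) (blinfun_apply x (E J)) = cinner (E I) (mat x (J, J) *\<^sub>C E J)"
      using J x[THEN conjunct2, rule_format, of I J]
      by (cases "I = J") (simp_all add: mat_def cinner_scaleC_right orthonormal)
  qed
  then show "x \<in> diagonal_ops T \<Theta> e"
    using x by (auto simp: diagonal_ops_def E_def)
qed

lemma diagonal_apply:
  assumes "a \<in> diagonal_ops T \<Theta> e" "J \<in> lists \<Theta>"
  shows "blinfun_apply a (E J) = mat a (J, J) *\<^sub>C E J"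
proof -
  obtain c where "blinfun_apply a (E J) = c *\<^sub>C E J"
    using assms by (auto simp: diagonal_ops_def E_def)
  then show ?thesis
    using assms(2) by (simp add: mat_def cinner_scaleC_right orthonormal)
qed

lemma diagonal_adjoint:
  assumes "a \<in> diagonal_ops T \<Theta> e"
  shows "adjoint_op a \<in> diagonal_ops T \<Theta> e"
  using assms adjoint_op_bounded by (auto simp: diagonal_iff mat_adjoint)

lemma mat_diagonal_left:
  assumes a: "a \<in> diagonal_ops T \<Theta> e"
  shows "mat (a o\<^sub>L x) (I, J) = mat a (I, I) * mat x (I, J)"
proof (cases "I \<in> lists \<Theta> \<and> J \<in> lists \<Theta>")
  case True
  have a': "a \<in> bounded_ops"
    using a by (simp add: diagonal_iff)
  have "cinner (E I) (blinfun_apply a (blinfun_apply x (E J))) = cinner (blinfun_apply (adjoint_op a) (E I)) (blinfun_apply x (E J))"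
    by (simp add: cinner_adjoint_left a')
  also have "\<dots> = mat a (I, I) * cinner (E I) (blinfun_apply x (E J))"
    using True by (simp add: diagonal_apply[OF diagonal_adjoint[OF a]] mat_adjoint[OF a'] cinner_scaleC_left)
  finally show ?thesis
    using True by (simp add: mat_def)
qed (auto simp: mat_def)

lemma mat_diagonal_right:
  assumes a: "a \<in> diagonal_ops T \<Theta> e" and x: "x \<in> bounded_ops"
  shows "mat (x o\<^sub>L a) (I, J) = mat x (I, J) * mat a (J, J)"
proof (cases "I \<in> lists \<Theta> \<and> J \<in> lists \<Theta>")
  case True
  then have "cinner (E I) (blinfun_apply x (blinfun_apply a (E J))) = mat a (J, J) * cinner (E I) (blinfun_apply x (E J))"
    by (simp add: diagonal_apply[OF a] op_scaleC[OF x] cinner_scaleC_right)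
  then show ?thesis
    using True by (simp add: mat_def)
qed (auto simp: mat_def)

lemma diagonal_op_exists:
  assumes "\<And>I. cmod (f I) \<le> C"
  obtains x where "x \<in> diagonal_ops T \<Theta> e" "\<And>I. I \<in> lists \<Theta> \<Longrightarrow> mat x (I, I) = f I"
proof -
  have C: "C \<ge> 0"
    using assms[of "[]"] norm_ge_zero order_trans by blast
  have bound: "(\<Sum>I\<in>S. (cmod (f I * cinner (E I) v))\<^sup>2) \<le> (C * norm v)\<^sup>2" if S: "finite S" "S \<subseteq> lists \<Theta>" for S v
  proof -
    have "(\<Sum>I\<in>S. (cmod (f I * cinner (E I) v))\<^sup>2) \<le> (\<Sum>I\<in>S. C\<^sup>2 * (cmod (cinner (E I) v))\<^sup>2)"
      using assms by (intro sum_mono) (auto simp: norm_mult power_mult_distrib intro!: mult_right_mono power_mono)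
    also have "\<dots> \<le> C\<^sup>2 * (norm v)\<^sup>2"
      using Bessel[OF S, of v] by (simp add: sum_distrib_left[symmetric] mult_left_mono)
    finally show ?thesis
      by (simp add: power_mult_distrib)
  qed
  obtain x where x: "x \<in> bounded_ops" "\<And>I v. I \<in> lists \<Theta> \<Longrightarrow> cinner (E I) (blinfun_apply x v) = f I * cinner (E I) v"
    by (rule op_from_coefficients[of "\<lambda>I v. f I * cinner (E I) v" C])
       (auto simp: cinner_add_right cinner_scaleC_right C algebra_simps intro: bound[unfolded power_mult_distrib])
  show ?thesis
  proof (rule that[of x])
    show "x \<in> diagonal_ops T \<Theta> e"
      using x by (auto simp: diagonal_iff mat_def orthonormal)
    show "mat x (I, I) = f I" if "I \<in> lists \<Theta>" for I
      using that x(2)[OF that] by (simp add: mat_def orthonormal)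
  qed
qed

section \<open>The Choi-Effros product\<close>

abbreviation ce :: "('f \<Rightarrow>\<^sub>L 'f) \<Rightarrow> ('f \<Rightarrow>\<^sub>L 'f) \<Rightarrow> ('f \<Rightarrow>\<^sub>L 'f)"  (infixl "\<circ>\<^sub>P" 70) where
  "ce \<equiv> choi_effros T \<Theta> e \<omega>"

definition D :: "('f \<Rightarrow>\<^sub>L 'f) set" where
  "D = diagonal_ops T \<Theta> e \<inter> harmonic_ops T \<Theta> e \<omega>"

lemma D_iff:
  "a \<in> D \<longleftrightarrow> a \<in> bounded_ops \<and> avg (mat a) = mat a \<and> (\<forall>I J. I \<noteq> J \<longrightarrow> mat a (I, J) = 0)"
  by (auto simp: D_def diagonal_iff harmonic_iff)

lemma choi_effros_eqI:
  assumes "sot_tendsto (\<lambda>n. (P ^^ n) (x o\<^sub>L y)) z sequentially"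
  shows "x \<circ>\<^sub>P y = z"
  unfolding choi_effros_def
proof (rule the_equality[where P = "\<lambda>z. sot_tendsto (\<lambda>n. (P ^^ n) (x o\<^sub>L y)) z sequentially", OF assms])
  fix z' assume "sot_tendsto (\<lambda>n. (P ^^ n) (x o\<^sub>L y)) z' sequentially"
  then show "z' = z"
    using assms unfolding sot_tendsto_def by (intro blinfun_eqI) (metis LIMSEQ_unique)
qed

text \<open>The step adds a letter to both words, so the length of the shorter one measures how far out a
  pair is.\<close>

definition len :: "'i list \<times> 'i list \<Rightarrow> nat" where
  "len s = min (length (fst s)) (length (snd s))"

lemma len_step: "len s < len (i # fst s, i # snd s)"
  by (simp add: len_def)

lemmas harmonic_eq_if_eq_far' = harmonic_eq_if_eq_far[of len, OF len_step]
  and eventually_fixed' = eventually_fixed[of len, OF len_step]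
  and avg_pow_restrict_far' = avg_pow_restrict_far[of len, OF len_step]

text \<open>Here the powers of \<open>P\<close> stabilize on \<open>x y\<close>, so the limit that defines the Choi-Effros product
  exists although \<open>x\<close> and \<open>y\<close> need not be diagonal.\<close>

lemma choi_effros_stable:
  assumes xy: "x \<in> bounded_ops" "y \<in> bounded_ops"
    and far: "\<And>s. len s \<ge> N \<Longrightarrow> avg (mat (x o\<^sub>L y)) s = mat (x o\<^sub>L y) s"
    and s: "len s \<ge> N"
  shows "mat (x \<circ>\<^sub>P y) s = mat (x o\<^sub>L y) s"
proof -
  let ?z = "x o\<^sub>L y"
  have z: "?z \<in> bounded_ops"
    by (rule bounded_ops_closed(3)[OF xy])
  have const: "(P ^^ n) ?z = (P ^^ N) ?z" if "n \<ge> N" for n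
  proof (rule mat_inject[OF markov_pow(1)[OF z] markov_pow(1)[OF z]])
    show "mat ((P ^^ n) ?z) = mat ((P ^^ N) ?z)"
      unfolding markov_pow(2)[OF z] by (rule eventually_fixed'(2)[OF far that])
  qed
  have "sot_tendsto (\<lambda>n. (P ^^ n) ?z) ((P ^^ N) ?z) sequentially"
    unfolding sot_tendsto_def
    by (intro allI tendsto_eventually eventually_sequentiallyI[of N]) (erule const[THEN arg_cong])
  then have "mat (x \<circ>\<^sub>P y) s = mat ((P ^^ N) ?z) s"
    by (simp add: choi_effros_eqI)
  also have "\<dots> = mat ?z s"
    unfolding markov_pow(2)[OF z] by (rule eventually_fixed'(3)[OF far s])
  finally show ?thesis .
qed

lemma mat_compose_D:
  assumes "a \<in> D" "b \<in> D"
  shows "mat (a o\<^sub>L b) s = mat a s * mat b s"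
proof (cases s)
  case (Pair I J)
  have "a \<in> diagonal_ops T \<Theta> e"
    using assms by (simp add: D_def)
  then show ?thesis
    using Pair assms(2) mat_diagonal_left[of a b I J] by (cases "I = J") (auto simp: D_iff)
qed

lemma diagonal_markov_pow:
  assumes "a \<in> diagonal_ops T \<Theta> e"
  shows "(P ^^ n) a \<in> diagonal_ops T \<Theta> e"
proof (induction n)
  case (Suc n)
  have "mat (P ((P ^^ n) a)) (I, J) = 0" if "I \<noteq> J" for I J
  proof -
    have "avg (mat ((P ^^ n) a)) (I, J) = avg (\<lambda>_. 0) (I, J)"
      by (rule avg_cong) (use Suc that in \<open>simp add: diagonal_iff\<close>)
    then show ?thesis
      using Suc by (simp add: mat_markov diagonal_iff avg_const)
  qed
  then show ?case
    using Suc by (simp add: diagonal_iff markov_bounded)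
qed (simp add: assms)

text \<open>The limits of the coefficients from \<open>product_limit\<close> form a bounded diagonal, hence an operator.
  The powers of \<open>P\<close> converge to it strongly, since they do so on basis vectors.\<close>

lemma choi_effros_D:
  assumes a: "a \<in> D" and b: "b \<in> D"
  shows "a \<circ>\<^sub>P b \<in> D"
    and "(\<lambda>n. (avg ^^ n) (\<lambda>s. mat a s * mat b s) s) \<longlonglongrightarrow> mat (a \<circ>\<^sub>P b) s"
proof -
  have ab: "a \<in> bounded_ops" "b \<in> bounded_ops" "a o\<^sub>L b \<in> bounded_ops"
    using a b by (auto simp: D_iff bounded_ops_closed)
  have mat_ab: "mat (a o\<^sub>L b) = (\<lambda>s. mat a s * mat b s)"
    using mat_compose_D[OF a b] by auto
  have harmonic: "avg (mat a) = mat a" "avg (mat b) = mat b"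
    using a b by (simp_all add: D_iff)
  obtain h where h: "avg h = h" "\<And>s. cmod (h s) \<le> norm a * norm b"
    "\<And>s. (\<lambda>n. (avg ^^ n) (\<lambda>s. mat a s * mat b s) s) \<longlonglongrightarrow> h s"
    by (rule product_limit[OF mat_bound[of a] harmonic(1) mat_bound[of b] harmonic(2)]) (rule that, simp_all)
  have lim: "(\<lambda>n. mat ((P ^^ n) (a o\<^sub>L b)) s) \<longlonglongrightarrow> h s" for s
    unfolding markov_pow(2)[OF ab(3)] mat_ab by (rule h(3))
  have diagonal: "(P ^^ n) (a o\<^sub>L b) \<in> diagonal_ops T \<Theta> e" for n
    by (rule diagonal_markov_pow) (use a ab in \<open>auto simp: diagonal_iff mat_ab D_iff\<close>)
  then have h_diag: "h (I, J) = 0" if "I \<noteq> J" for I J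
    using lim[of "(I, J)"] that diagonal LIMSEQ_unique[OF _ tendsto_const[of 0]]
    by (simp add: diagonal_iff)
  have h_outside: "h (I, J) = 0" if "I \<notin> lists \<Theta>" for I J
    using lim[of "(I, J)"] that LIMSEQ_unique[OF _ tendsto_const[of 0]] by (simp add: mat_def)
  obtain z where z: "z \<in> diagonal_ops T \<Theta> e" "\<And>I. I \<in> lists \<Theta> \<Longrightarrow> mat z (I, I) = h (I, I)"
    using diagonal_op_exists[of "\<lambda>I. h (I, I)" "norm a * norm b"] h(2) by blast
  have mat_z: "mat z = h"
  proof
    fix s
    show "mat z s = h s"
    proof (cases s)
      case (Pair I J)
      have "mat z (I, J) = 0" if "I \<noteq> J"
        using z(1) that by (simp add: diagonal_iff)
      moreover have "mat z (I, J) = 0" if "I \<notin> lists \<Theta>"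
        using that by (simp add: mat_def)
      ultimately show ?thesis
        using z(2)[of I] h_diag[of I J] h_outside[of I J] Pair by metis
    qed
  qed
  have "sot_tendsto (\<lambda>n. (P ^^ n) (a o\<^sub>L b)) z sequentially"
  proof (rule sot_tendsto_if_on_basis)
    fix J assume J: "J \<in> lists \<Theta>"
    have "blinfun_apply ((P ^^ n) (a o\<^sub>L b)) (E J) = mat ((P ^^ n) (a o\<^sub>L b)) (J, J) *\<^sub>C E J" for n
      by (rule diagonal_apply[OF diagonal J])
    moreover have "(\<lambda>n. mat ((P ^^ n) (a o\<^sub>L b)) (J, J) *\<^sub>C E J) \<longlonglongrightarrow> h (J, J) *\<^sub>C E J"
      by (rule bounded_linear.tendsto[OF bounded_linear_scaleC_left lim])
    ultimately show "(\<lambda>n. blinfun_apply ((P ^^ n) (a o\<^sub>L b)) (E J)) \<longlonglongrightarrow> blinfun_apply z (E J)"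
      by (simp add: diagonal_apply[OF z(1) J] mat_z)
  qed (use z(1) markov_pow[OF ab(3)] in \<open>auto simp: diagonal_iff\<close>)
  then have ce: "a \<circ>\<^sub>P b = z"
    by (rule choi_effros_eqI)
  then show "a \<circ>\<^sub>P b \<in> D"
    using z(1) h(1) by (simp add: D_def harmonic_iff diagonal_iff mat_z)
  show "(\<lambda>n. (avg ^^ n) (\<lambda>s. mat a s * mat b s) s) \<longlonglongrightarrow> mat (a \<circ>\<^sub>P b) s"
    using h(3) by (simp add: ce mat_z)
qed

lemma choi_effros_D_commute:
  assumes "a \<in> D" "b \<in> D"
  shows "a \<circ>\<^sub>P b = b \<circ>\<^sub>P a"
proof -
  have "a o\<^sub>L b = b o\<^sub>L a"
    by (rule mat_inject)
       (use assms in \<open>auto simp: D_iff bounded_ops_closed mat_compose_D mult.commute fun_eq_iff\<close>)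
  then show ?thesis
    by (simp add: choi_effros_def)
qed

subsection \<open>The diagonal harmonic operators form a von Neumann subalgebra\<close>

lemma id_in_D: "id_blinfun \<in> D"
  unfolding D_iff
proof (intro conjI allI impI)
  show "avg (mat id_blinfun) = mat id_blinfun"
  proof
    fix s
    have "avg (mat id_blinfun) s = avg (\<lambda>_. mat id_blinfun s) s"
      by (rule avg_cong) (cases s, auto simp: mat_id)
    then show "avg (mat id_blinfun) s = mat id_blinfun s"
      by (simp add: avg_const)
  qed
qed (simp_all add: mat_id bounded_ops_closed)

lemma mat_adjoint_D: "a \<in> D \<Longrightarrow> mat (adjoint_op a) s = cnj (mat a s)"
  by (cases s, cases "fst s = snd s") (auto simp: D_iff mat_adjoint)

lemma D_closed:
  assumes "a \<in> D"
  shows "b \<in> D \<Longrightarrow> a + b \<in> D" "scaleC_op c a \<in> D" "adjoint_op a \<in> D"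
proof -
  show "a + b \<in> D" if "b \<in> D"
    using assms that avg_add[OF mat_bound[of a] mat_bound[of b]]
    by (auto simp: D_iff mat_add bounded_ops_closed)
  show "scaleC_op c a \<in> D"
    using assms by (auto simp: D_iff mat_scaleC bounded_ops_closed avg_cmult)
  have "mat (adjoint_op a) = (\<lambda>s. cnj (mat a s))"
    using mat_adjoint_D[OF assms] by auto
  then show "adjoint_op a \<in> D"
    using assms by (auto simp: D_iff adjoint_op_bounded avg_cnj)
qed

text \<open>A vector functional is a series functional with a single nonzero term.\<close>

lemma continuous_coefficient:
  fixes v w :: 'f
  assumes "open U"
  shows "openin sigma_weak {x. x \<in> bounded_ops \<and> cinner v (blinfun_apply x w) \<in> U}"
proof -
  define \<xi> where "\<xi> = (\<lambda>k::nat. if k = 0 then v else 0)"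
  define \<eta> where "\<eta> = (\<lambda>k::nat. if k = 0 then w else 0)"
  have "(\<Sum>k. cinner (\<xi> k) (blinfun_apply x (\<eta> k))) = cinner v (blinfun_apply x w)" for x :: "'f \<Rightarrow>\<^sub>L 'f"
    by (subst suminf_finite[of "{0}"]) (auto simp: \<xi>_def \<eta>_def)
  moreover have "summable (\<lambda>k. (norm (\<xi> k))\<^sup>2)" "summable (\<lambda>k. (norm (\<eta> k))\<^sup>2)"
    by (rule summable_finite[of "{0}"]; simp add: \<xi>_def \<eta>_def)+
  ultimately show ?thesis
    unfolding sigma_weak_def using assms
    by (intro topology_generated_by_Basis CollectI exI[of _ \<xi>] exI[of _ \<eta>] exI[of _ U]) simp
qed

lemma topspace_sigma_weak: "topspace (sigma_weak :: ('f \<Rightarrow>\<^sub>L 'f) topology) = bounded_ops"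
proof
  show "topspace (sigma_weak :: ('f \<Rightarrow>\<^sub>L 'f) topology) \<subseteq> bounded_ops"
    unfolding sigma_weak_def topology_generated_by_topspace by auto
  have "openin sigma_weak {x. x \<in> bounded_ops \<and> cinner (0::'f) (blinfun_apply x 0) \<in> UNIV}"
    by (rule continuous_coefficient) simp
  then show "bounded_ops \<subseteq> topspace (sigma_weak :: ('f \<Rightarrow>\<^sub>L 'f) topology)"
    using openin_subset by fastforce
qed

lemma closedin_D: "closedin (subtopology sigma_weak (harmonic_ops T \<Theta> e \<omega>)) D"
proof -
  define Z where "Z = (\<lambda>s. {x \<in> bounded_ops :: ('f \<Rightarrow>\<^sub>L 'f) set. mat x s = 0})"
  have "closedin sigma_weak (Z s)" for s
  proof (cases "fst s \<in> lists \<Theta> \<and> snd s \<in> lists \<Theta>")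
    case True
    have "bounded_ops - Z s = {x. x \<in> bounded_ops \<and> cinner (E (fst s)) (blinfun_apply x (E (snd s))) \<in> - {0}}"
      using True by (auto simp: Z_def mat_def)
    then show ?thesis
      using continuous_coefficient[of "- {0}" "E (fst s)" "E (snd s)"]
      by (auto simp: closedin_def topspace_sigma_weak Z_def)
  next
    case False
    then have "Z s = topspace sigma_weak"
      by (auto simp: Z_def mat_def topspace_sigma_weak)
    then show ?thesis by simp
  qed
  then have "closedin sigma_weak (\<Inter> (Z ` {s. fst s \<noteq> snd s}))"
    by (intro closedin_Inter) auto
  moreover have "D = harmonic_ops T \<Theta> e \<omega> \<inter> \<Inter> (Z ` {s. fst s \<noteq> snd s})"
    by (auto simp: D_def Z_def diagonal_iff harmonic_iff)
  ultimately show ?thesis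
    by (auto simp: closedin_subtopology)
qed

section \<open>Maximality\<close>

text \<open>The indicator function \<open>q\<close> of the words ending in \<open>K\<close> is unchanged by a step at words that are at
  least as long as \<open>K\<close>. Averaging it \<open>length K\<close> times corrects its values at the shorter words.\<close>

lemma suffix_projection:
  assumes K: "K \<in> lists \<Theta>"
  obtains p where "p \<in> D"
    "\<And>I. I \<in> lists \<Theta> \<Longrightarrow> length I \<ge> length K \<Longrightarrow> mat p (I, I) = of_bool (suffix K I)"
proof -
  obtain q where q: "q \<in> diagonal_ops T \<Theta> e"
    "\<And>I. I \<in> lists \<Theta> \<Longrightarrow> mat q (I, I) = of_bool (suffix K I)"
    by (rule diagonal_op_exists[of "\<lambda>I. of_bool (suffix K I)" 1]) auto
  have q_bounded: "q \<in> bounded_ops"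
    using q(1) by (simp add: diagonal_iff)
  have far: "avg (mat q) s = mat q s" if s: "len s \<ge> length K" for s
  proof -
    have "mat q (i # fst s, i # snd s) = mat q s" if i: "i \<in> \<Theta>" for i
    proof (cases "fst s = snd s \<and> fst s \<in> lists \<Theta>")
      case True
      then obtain I where "s = (I, I)" "I \<in> lists \<Theta>"
        by (cases s) auto
      then show ?thesis
        using s i q(2)[of I] q(2)[of "i # I"] by (auto simp: len_def suffix_Cons)
    next
      case False
      have "mat q t = 0" if "fst t \<noteq> snd t" for t
        using q(1) that by (cases t) (simp add: diagonal_iff)
      moreover have "mat q t = 0" if "fst t \<notin> lists \<Theta>" for t
        using that by (simp add: mat_def)
      ultimately show ?thesis
        using False i by (cases "fst s = snd s") simp_all
    qed
    then have "avg (mat q) s = avg (\<lambda>_. mat q s) s"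
      by (intro avg_cong) simp
    then show ?thesis
      by (simp add: avg_const)
  qed
  let ?p = "(P ^^ length K) q"
  have mat_p: "mat ?p = (avg ^^ length K) (mat q)"
    by (rule markov_pow(2)[OF q_bounded])
  show ?thesis
  proof (rule that[of ?p])
    have "avg (mat ?p) = mat ?p"
      unfolding mat_p by (rule eventually_fixed'(1)[OF far])
    then show "?p \<in> D"
      using diagonal_markov_pow[OF q(1)] by (simp add: D_iff diagonal_iff)
    show "mat ?p (I, I) = of_bool (suffix K I)" if I: "I \<in> lists \<Theta>" "length I \<ge> length K" for I
    proof -
      have "mat ?p (I, I) = mat q (I, I)"
        unfolding mat_p by (rule eventually_fixed'(3)[OF far]) (use I in \<open>simp_all add: len_def\<close>)
      then show ?thesis
        by (simp only: q(2)[OF I(1)])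
    qed
  qed
qed

lemma suffix_step: "length K \<le> length I \<Longrightarrow> suffix K (i # I) \<longleftrightarrow> suffix K I"
  by (auto simp: suffix_Cons)

text \<open>With the projection \<open>p\<close> that belongs to the words ending in \<open>K\<close>, both \<open>p x\<close> and \<open>x p\<close> are harmonic at long
  words: there they are \<open>x\<close> times a factor that a step does not change. Commuting means that the two
  factors agree wherever \<open>x\<close> does not vanish.\<close>

lemma commuting_suffix_condition:
  assumes x: "x \<in> harmonic_ops T \<Theta> e \<omega>" and commute: "\<And>a. a \<in> D \<Longrightarrow> a \<circ>\<^sub>P x = x \<circ>\<^sub>P a"
    and K: "K \<in> lists \<Theta>" and IJ: "length K \<le> length I" "length K \<le> length J"
    and nz: "mat x (I, J) \<noteq> 0"
  shows "suffix K I \<longleftrightarrow> suffix K J"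
proof -
  obtain p where p: "p \<in> D"
    "\<And>I. I \<in> lists \<Theta> \<Longrightarrow> length I \<ge> length K \<Longrightarrow> mat p (I, I) = of_bool (suffix K I)"
    using suffix_projection[OF K] by blast
  have pd: "p \<in> diagonal_ops T \<Theta> e" "p \<in> bounded_ops" and xb: "x \<in> bounded_ops" "avg (mat x) = mat x"
    using p(1) x by (auto simp: D_def diagonal_iff harmonic_iff)
  have left: "mat (p o\<^sub>L x) s = of_bool (suffix K (fst s)) * mat x s" if "len s \<ge> length K" for s
    using that p(2)[of "fst s"] mat_diagonal_left[OF pd(1), of x "fst s" "snd s"]
    by (cases "fst s \<in> lists \<Theta>") (simp_all add: len_def, simp_all add: mat_def)
  have right: "mat (x o\<^sub>L p) s = of_bool (suffix K (snd s)) * mat x s" if "len s \<ge> length K" for s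
    using that p(2)[of "snd s"] mat_diagonal_right[OF pd(1) xb(1), of "fst s" "snd s"]
    by (cases "snd s \<in> lists \<Theta>") (simp_all add: len_def, simp_all add: mat_def)
  have far: "avg (mat z) s = mat z s"
    if z: "\<And>s. len s \<ge> length K \<Longrightarrow> mat z s = of_bool (suffix K (c s)) * mat x s"
      and c: "c = fst \<or> c = snd" and s: "len s \<ge> length K" for z c s
  proof -
    have "(avg ^^ 1) (mat z) s = of_bool (suffix K (c s)) * (avg ^^ 1) (mat x) s"
    proof (rule avg_pow_restrict_far'[OF _ z s])
      fix i s assume "len s \<ge> length K"
      then show "of_bool (suffix K (c (i # fst s, i # snd s))) = (of_bool (suffix K (c s)) :: complex)"
        using c by (auto simp: len_def suffix_step)
    qed
    then show ?thesis
      using z[OF s] xb(2) by simp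
  qed
  have s: "len (I, J) \<ge> length K"
    using IJ by (simp add: len_def)
  have "mat (p \<circ>\<^sub>P x) (I, J) = of_bool (suffix K I) * mat x (I, J)"
    using choi_effros_stable[OF pd(2) xb(1) far[OF left disjI1[OF refl]] s] left[OF s] by simp
  moreover have "mat (x \<circ>\<^sub>P p) (I, J) = of_bool (suffix K J) * mat x (I, J)"
    using choi_effros_stable[OF xb(1) pd(2) far[OF right disjI2[OF refl]] s] right[OF s] by simp
  ultimately show ?thesis
    using commute[OF p(1)] nz by auto
qed

text \<open>Let \<open>I \<noteq> J\<close>. If \<open>x\<close> does not vanish at \<open>(i # I, i # J)\<close>, then one of these words is a proper suffix
  of the other; the longer of \<open>I\<close> and \<open>J\<close> then determines \<open>i\<close>. So \<open>x\<close> lives on a single path.\<close>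

lemma commutant_subset_D:
  assumes x: "x \<in> harmonic_ops T \<Theta> e \<omega>" and commute: "\<And>a. a \<in> D \<Longrightarrow> a \<circ>\<^sub>P x = x \<circ>\<^sub>P a"
  shows "x \<in> D"
proof -
  \<comment> \<open>Take the shorter one of the two words as \<open>K\<close>.\<close>
  have comparable: "if length J \<le> length I then suffix J I else suffix I J" if nz: "mat x (I, J) \<noteq> 0" for I J
  proof -
    have "I \<in> lists \<Theta>" "J \<in> lists \<Theta>"
      using nz by (auto simp: mat_def split: if_splits)
    then show ?thesis
      using commuting_suffix_condition[OF x commute, of I I J] commuting_suffix_condition[OF x commute, of J I J] nz
      by auto
  qed
  have "mat x (I, J) = 0" if "I \<noteq> J" for I J
  proof (rule harmonic_single_path_zero[OF mat_bound, where R = "{s. fst s \<noteq> snd s}"])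
    show "avg (mat x) = mat x"
      using x by (simp add: harmonic_iff)
    show "(I, J) \<in> {s. fst s \<noteq> snd s}"
      using that by simp
    fix i j and s :: "'i list \<times> 'i list"
    assume s: "s \<in> {s. fst s \<noteq> snd s}"
      and nz: "mat x (i # fst s, i # snd s) \<noteq> 0" "mat x (j # fst s, j # snd s) \<noteq> 0"
    obtain I J where IJ: "s = (I, J)" "I \<noteq> J"
      using s by (cases s) auto
    have "i # J = j # J" if "length J \<le> length I"
      using comparable[OF nz(1)] comparable[OF nz(2)] IJ that suffix_length_suffix[of "i # J" I "j # J"]
      by (auto simp: suffix_Cons dest: suffix_length_le)
    moreover have "i # I = j # I" if "\<not> length J \<le> length I"
      using comparable[OF nz(1)] comparable[OF nz(2)] IJ that suffix_length_suffix[of "i # I" J "j # I"]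
      by (auto simp: suffix_Cons dest: suffix_length_le)
    ultimately show "i = j"
      by blast
  qed auto
  then show ?thesis
    using x by (simp add: D_iff harmonic_iff)
qed

theorem masa_D: "masa (poisson_boundary T \<Theta> e \<omega>) D"
proof -
  have "vn_subalgebra (poisson_boundary T \<Theta> e \<omega>) D"
    using closedin_D by (auto simp: vn_subalgebra_def poisson_boundary_def id_in_D D_closed choi_effros_D D_def[symmetric])
       (simp add: D_def)
  moreover have "relative_commutant (poisson_boundary T \<Theta> e \<omega>) D = D"
    by (auto simp: relative_commutant_def poisson_boundary_def intro: commutant_subset_D choi_effros_D_commute)
       (simp add: D_def)
  ultimately show ?thesis
    using choi_effros_D_commute by (simp add: masa_def poisson_boundary_def)
qed

section \<open>Diffuseness\<close>

text \<open>At long words a step-invariant factor can be pulled out of the limit that defines the product. This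
  replaces associativity of the product in the identities for subprojections.\<close>

lemma product_far:
  assumes D: "a \<in> D" "b \<in> D" "c \<in> D" "d \<in> D"
    and \<kappa>: "\<And>i s. i \<in> \<Theta> \<Longrightarrow> len s \<ge> N \<Longrightarrow> \<kappa> (i # fst s, i # snd s) = \<kappa> s"
    and ab: "\<And>s. len s \<ge> N \<Longrightarrow> mat a s * mat b s = \<kappa> s * (mat c s * mat d s)"
    and s: "len s \<ge> N"
  shows "mat (a \<circ>\<^sub>P b) s = \<kappa> s * mat (c \<circ>\<^sub>P d) s"
proof (rule LIMSEQ_unique[OF choi_effros_D(2)[OF D(1,2)]])
  have "(\<lambda>n. \<kappa> s * (avg ^^ n) (\<lambda>s. mat c s * mat d s) s) \<longlonglongrightarrow> \<kappa> s * mat (c \<circ>\<^sub>P d) s"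
    by (intro tendsto_mult tendsto_const choi_effros_D(2)[OF D(3,4)])
  moreover have "(avg ^^ n) (\<lambda>s. mat a s * mat b s) s = \<kappa> s * (avg ^^ n) (\<lambda>s. mat c s * mat d s) s" for n
    by (rule avg_pow_restrict_far'[OF \<kappa> ab s])
  ultimately show "(\<lambda>n. (avg ^^ n) (\<lambda>s. mat a s * mat b s) s) \<longlonglongrightarrow> \<kappa> s * mat (c \<circ>\<^sub>P d) s"
    by simp
qed

lemma D_eqI:
  assumes "a \<in> D" "b \<in> D" "\<And>s. len s \<ge> N \<Longrightarrow> mat a s = mat b s"
  shows "a = b"
proof (rule mat_inject)
  show "mat a = mat b"
    by (rule harmonic_eq_if_eq_far'[where N = N]) (use assms in \<open>auto simp: D_iff\<close>)
qed (use assms in \<open>auto simp: D_iff\<close>)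

text \<open>The part of \<open>p\<close> on the words ending in \<open>K\<close>. All identities are checked at long words, where the
  factor \<open>\<kappa>\<close> is idempotent and invariant.\<close>

lemma subprojection_on_suffix:
  assumes p: "p \<in> D" "adjoint_op p = p" "p \<circ>\<^sub>P p = p" and K: "K \<in> lists \<Theta>"
  obtains q where "q \<in> D" "adjoint_op q = q" "q \<circ>\<^sub>P q = q" "p \<circ>\<^sub>P q = q"
    "\<And>s. len s \<ge> length K \<Longrightarrow> mat q s = of_bool (suffix K (fst s)) * mat p s"
proof -
  obtain f where f: "f \<in> D"
    "\<And>I. I \<in> lists \<Theta> \<Longrightarrow> length I \<ge> length K \<Longrightarrow> mat f (I, I) = of_bool (suffix K I)"
    using suffix_projection[OF K] by blast
  define \<kappa> :: "'i list \<times> 'i list \<Rightarrow> complex" where "\<kappa> = (\<lambda>s. of_bool (suffix K (fst s)))"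
  define q where "q = f \<circ>\<^sub>P p"
  have \<kappa>: "\<kappa> (i # fst s, i # snd s) = \<kappa> s" if "len s \<ge> length K" for i s
    using that by (simp add: \<kappa>_def len_def suffix_step)
  have q: "q \<in> D"
    unfolding q_def by (rule choi_effros_D(1)[OF f(1) p(1)])
  have fp: "mat f s * mat p s = \<kappa> s * (mat p s * mat id_blinfun s)" if "len s \<ge> length K" for s
  proof (cases "fst s = snd s \<and> fst s \<in> lists \<Theta>")
    case True
    then obtain I where "s = (I, I)" "I \<in> lists \<Theta>"
      by (cases s) auto
    then show ?thesis
      using f(2)[of I] that mat_id[of I I] by (simp add: \<kappa>_def len_def)
  next
    case False
    then have "mat p s = 0"
      using p(1) by (cases s, cases "fst s = snd s") (auto simp: D_iff mat_def)
    then show ?thesis by simp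
  qed
  have unit: "p \<circ>\<^sub>P id_blinfun = p"
  proof (rule choi_effros_eqI)
    have "(P ^^ n) p = p" for n
      using p(1) by (induction n) (simp_all add: D_def harmonic_ops_def)
    moreover have "p o\<^sub>L id_blinfun = p"
      by (rule blinfun_eqI) simp
    ultimately show "sot_tendsto (\<lambda>n. (P ^^ n) (p o\<^sub>L id_blinfun)) p sequentially"
      by (simp add: sot_tendsto_def)
  qed
  have mat_q: "mat q s = \<kappa> s * mat p s" if "len s \<ge> length K" for s
    using product_far[OF f(1) p(1) p(1) id_in_D \<kappa> fp that] by (simp add: q_def unit)
  have idem: "\<kappa> s * \<kappa> s = \<kappa> s" for s
    by (simp add: \<kappa>_def)
  show ?thesis
  proof (rule that[OF q])
    show "adjoint_op q = q"
    proof (rule D_eqI[OF D_closed(3)[OF q] q])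
      fix s :: "'i list \<times> 'i list" assume s: "len s \<ge> length K"
      have "cnj (mat p s) = mat p s"
        using mat_adjoint_D[OF p(1), of s] p(2) by simp
      then show "mat (adjoint_op q) s = mat q s"
        by (simp add: mat_adjoint_D[OF q] mat_q[OF s]) (simp add: \<kappa>_def)
    qed
    show "q \<circ>\<^sub>P q = q"
    proof (rule D_eqI[OF choi_effros_D(1)[OF q q] q])
      fix s :: "'i list \<times> 'i list" assume s: "len s \<ge> length K"
      have "mat (q \<circ>\<^sub>P q) s = \<kappa> s * mat (p \<circ>\<^sub>P p) s"
      proof (rule product_far[OF q q p(1) p(1) \<kappa> _ s])
        fix s :: "'i list \<times> 'i list" assume "len s \<ge> length K"
        then show "mat q s * mat q s = \<kappa> s * (mat p s * mat p s)"
          using idem[of s] by (simp add: mat_q) (metis mult.assoc mult.left_commute)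
      qed
      then show "mat (q \<circ>\<^sub>P q) s = mat q s"
        by (simp add: p(3) mat_q[OF s])
    qed
    show "p \<circ>\<^sub>P q = q"
    proof (rule D_eqI[OF choi_effros_D(1)[OF p(1) q] q])
      fix s :: "'i list \<times> 'i list" assume s: "len s \<ge> length K"
      have "mat (p \<circ>\<^sub>P q) s = \<kappa> s * mat (p \<circ>\<^sub>P p) s"
        by (rule product_far[OF p(1) q p(1) p(1) \<kappa> _ s]) (simp_all add: mat_q)
      then show "mat (p \<circ>\<^sub>P q) s = mat q s"
        by (simp add: p(3) mat_q[OF s])
    qed
    show "mat q s = of_bool (suffix K (fst s)) * mat p s" if "len s \<ge> length K" for s
      using mat_q[OF that] by (simp add: \<kappa>_def)
  qed
qed

text \<open>The subprojections on the words ending in \<open>i # I\<close> are orthogonal for different letters \<open>i\<close>, so at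
  most one of them can be all of a minimal projection \<open>p\<close>, and \<open>p\<close> lives on a single path.\<close>

theorem diffuse_D: "diffuse (poisson_boundary T \<Theta> e \<omega>) D"
proof -
  have False if "minimal_projection (poisson_boundary T \<Theta> e \<omega>) D p" for p
  proof -
    have p: "p \<in> D" "adjoint_op p = p" "p \<circ>\<^sub>P p = p" "p \<noteq> 0"
      and minimal: "\<And>q. \<lbrakk>q \<in> D; adjoint_op q = q; q \<circ>\<^sub>P q = q; p \<circ>\<^sub>P q = q\<rbrakk> \<Longrightarrow> q = 0 \<or> q = p"
      using that by (auto simp: minimal_projection_def projections_def poisson_boundary_def)
    have "mat p s = 0" for s
    proof (rule harmonic_single_path_zero[OF mat_bound, where R = UNIV])
      show "avg (mat p) = mat p"
        using p(1) by (simp add: D_iff)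
      fix i j and s :: "'i list \<times> 'i list"
      assume nz: "mat p (i # fst s, i # snd s) \<noteq> 0" "mat p (j # fst s, j # snd s) \<noteq> 0"
      then obtain I where s: "s = (I, I)"
        using p(1) by (cases s, cases "fst s = snd s") (auto simp: D_iff)
      have K: "i # I \<in> lists \<Theta>"
        using nz(1) by (auto simp: s mat_def split: if_splits)
      obtain q where q: "q \<in> D" "adjoint_op q = q" "q \<circ>\<^sub>P q = q" "p \<circ>\<^sub>P q = q"
        "\<And>s. len s \<ge> length (i # I) \<Longrightarrow> mat q s = of_bool (suffix (i # I) (fst s)) * mat p s"
        by (rule subprojection_on_suffix[OF p(1-3) K]) (rule that)
      have "mat q (i # I, i # I) \<noteq> 0"
        using q(5)[of "(i # I, i # I)"] nz(1) by (simp add: s len_def)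
      then have "q \<noteq> 0"
        by (auto simp: mat_def blinfun.zero_left split: if_splits)
      then have "q = p"
        using minimal[OF q(1-4)] by blast
      then have "suffix (i # I) (j # I)"
        using q(5)[of "(j # I, j # I)"] nz(2) by (auto simp: s len_def split: if_splits)
      then show "i = j"
        by (auto simp: suffix_Cons dest: suffix_length_le)
    qed auto
    then have "mat p = mat 0"
      by (auto simp: mat_def blinfun.zero_left)
    then have "p = 0"
      using p(1) by (intro mat_inject) (auto simp: D_iff bounded_ops_def)
    then show False
      using p(4) by blast
  qed
  then show ?thesis
    by (auto simp: diffuse_def)
qed

end

theorem theoremA:
  fixes \<Theta> :: "nat set"
    and e :: "nat \<Rightarrow> 'h::chilbert_space"
    and T :: "'h list \<Rightarrow> 'f::chilbert_space"
    and \<omega> :: "nat \<Rightarrow> real"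
  assumes "(\<exists>n>1. \<Theta> = {1..n}) \<or> \<Theta> = {1..}"
    and "orthonormal_basis_on \<Theta> e"
    and "full_fock_space T"
    and "\<And>i. i \<in> \<Theta> \<Longrightarrow> \<omega> i > 0"
    and "(\<omega> has_sum 1) \<Theta>"
  shows "masa (poisson_boundary T \<Theta> e \<omega>) (diagonal_ops T \<Theta> e \<inter> harmonic_ops T \<Theta> e \<omega>) \<and>
    diffuse (poisson_boundary T \<Theta> e \<omega>) (diagonal_ops T \<Theta> e \<inter> harmonic_ops T \<Theta> e \<omega>)"
proof -
  have "1 \<in> \<Theta>" "2 \<in> \<Theta>"
    using assms(1) by auto
  then have "\<exists>a\<in>\<Theta>. \<exists>b\<in>\<Theta>. a \<noteq> b"
    by (intro bexI[of _ 1] bexI[of _ 2]) auto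
  then interpret fock_walk \<Theta> e T \<omega>
    by unfold_locales (use assms in auto)
  show ?thesis
    using masa_D diffuse_D by (simp add: D_def)
qed

end
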